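(* Let $n\ge1$, let $H=(-\Delta)^\alpha$ on $L^2(\mathbb{R}^n)$ with $\alpha>\frac12$, and let $T\neq0$ be real. If $u(t)=e^{-itH}u_0$ with $u_0\in L^2(\mathbb{R}^n)$ satisfies $\operatorname{supp}u(0)\subset E$ and $\operatorname{supp}u(T)\subset F$ for two compact sets $E,F\subset\mathbb{R}^n$, then $u\equiv0$.
   Context: For $\alpha>0$, $(-\Delta)^\alpha$ is the nonnegative selfadjoint operator on $L^2(\mathbb{R}^n)$ with Fourier multiplier $|\xi|^{2\alpha}$, so that $u(t)=e^{-itH}u_0$ means $\widehat{u}(t,\xi)=e^{-it|\xi|^{2\alpha}}\widehat{u_0}(\xi)$. *)

theory Defs
  imports "HOL-Analysis.Analysis"
begin

text \<open>Elements of \<open>L\<^sup>2\<close> are represented by functions; equality in \<open>L\<^sup>2\<close> is equality almost everywhere.\<close>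

definition L2 :: "('a::euclidean_space \<Rightarrow> complex) set" where
  "L2 = {f. f \<in> borel_measurable lebesgue \<and> integrable lebesgue (\<lambda>x. (cmod (f x))\<^sup>2)}"

text \<open>The support of an \<open>L\<^sup>2\<close> function, independent of the representative: the complement of the
  largest open set on which the function vanishes almost everywhere.\<close>

definition ess_supp :: "('a::euclidean_space \<Rightarrow> complex) \<Rightarrow> 'a set" where
  "ess_supp f = - \<Union>{U. open U \<and> (AE x in lebesgue. x \<in> U \<longrightarrow> f x = 0)}"

definition fourier_L1 :: "('a::euclidean_space \<Rightarrow> complex) \<Rightarrow> 'a \<Rightarrow> complex" where
  "fourier_L1 f \<xi> =
     of_real ((2 * pi) powr (- real DIM('a) / 2)) * (LINT x|lebesgue. cis (- (x \<bullet> \<xi>)) * f x)"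

text \<open>\<open>fourier_L2 f g\<close> says that \<open>g\<close> represents the Fourier--Plancherel transform of \<open>f\<close>: the
  integrals over balls of radius \<open>R\<close> converge to \<open>g\<close> in \<open>L\<^sup>2\<close> as \<open>R\<close> tends to infinity.
  (The truncations of \<open>f\<close> lie in both \<open>L\<^sup>1\<close> and \<open>L\<^sup>2\<close>.) It is a relation because \<open>g\<close> is determined
  only up to null sets; by Plancherel's theorem every \<open>f\<close> in \<open>L\<^sup>2\<close> has such a \<open>g\<close>.\<close>

definition fourier_L2 ::
  "('a::euclidean_space \<Rightarrow> complex) \<Rightarrow> ('a \<Rightarrow> complex) \<Rightarrow> bool" where
  "fourier_L2 f g \<longleftrightarrow> f \<in> L2 \<and> g \<in> L2 \<and>
     ((\<lambda>R::real. \<integral>\<^sup>+ \<xi>. ennreal ((cmod (fourier_L1 (\<lambda>x. indicator (cball 0 R) x * f x) \<xi> - g \<xi>))\<^sup>2) \<partial>lebesgue)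
        \<longlongrightarrow> 0) at_top"

text \<open>\<open>fourier_multiplier m f g\<close>: \<open>f\<close> is in the domain of the operator on \<open>L\<^sup>2\<close> with Fourier
  multiplier \<open>m\<close>, and \<open>g\<close> represents its value at \<open>f\<close>.\<close>

definition fourier_multiplier ::
  "('a::euclidean_space \<Rightarrow> complex) \<Rightarrow> ('a \<Rightarrow> complex) \<Rightarrow> ('a \<Rightarrow> complex) \<Rightarrow> bool" where
  "fourier_multiplier m f g \<longleftrightarrow> (\<exists>h. fourier_L2 f h \<and> fourier_L2 g (\<lambda>\<xi>. m \<xi> * h \<xi>))"

definition frac_laplacian_symbol :: "real \<Rightarrow> 'a::euclidean_space \<Rightarrow> real" where
  "frac_laplacian_symbol \<alpha> \<xi> = norm \<xi> powr (2 * \<alpha>)"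

text \<open>\<open>propagator \<alpha> t f g\<close>: \<open>g = e\<^sup>-\<^sup>i\<^sup>t\<^sup>H f\<close> for \<open>H\<close> the operator with Fourier multiplier
  \<open>frac_laplacian_symbol \<alpha>\<close>.\<close>

definition propagator ::
  "real \<Rightarrow> real \<Rightarrow> ('a::euclidean_space \<Rightarrow> complex) \<Rightarrow> ('a \<Rightarrow> complex) \<Rightarrow> bool" where
  "propagator \<alpha> t = fourier_multiplier (\<lambda>\<xi>. exp (- \<i> * of_real t * of_real (frac_laplacian_symbol \<alpha> \<xi>)))"

end

theory Submission
  imports Defs "HOL-Complex_Analysis.Conformal_Mappings" "HOL-Probability.Characteristic_Functions"
    "HOL-Probability.Sinc_Integral"
begin

text \<open>
  Let \<open>f = u(0)\<close> and \<open>g = u(T)\<close>. Along a line through the origin the Fourier transforms of the compactly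
  supported \<open>f\<close>, \<open>g\<close> are entire functions \<open>\<Phi>\<close>, \<open>\<Gamma>\<close> of exponential type with
  \<open>\<Gamma>(s) = exp (- i T' s\<^sup>2\<^sup>\<alpha>) \<Phi>(s)\<close> for \<open>s > 0\<close>, hence in the right half plane. On the ray of angle
  \<open>sgn T' \<cdot> \<pi> / (4\<alpha>)\<close> the factor has modulus \<open>exp (|T'| r\<^sup>2\<^sup>\<alpha>)\<close>, and since \<open>2\<alpha> > 1\<close>, \<open>\<Phi>\<close> decays there faster
  than every exponential. Its Laplace transform along that ray is therefore entire; but for an entire
  function of exponential type it is also, near infinity, a power series in \<open>1/w\<close> vanishing at infinity
  and carrying the Taylor coefficients of \<open>\<Phi>\<close>. By Liouville all of these vanish.

  So the transform of \<open>u\<^sub>0\<close> is zero, and it remains to know that the transform is injective on \<open>L\<^sup>2\<close>. This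
  follows by pairing with functions whose transforms are box indicators smoothed by narrow Gaussians.
\<close>

subsection \<open>Functions of exponential type\<close>

text \<open>Dominated convergence applied to the partial sums. Each term is a difference of two
  consecutive partial sums, so \<open>2 * w\<close> bounds it and makes it integrable. Bounding
  partial sums is what fits power series of exponential type.\<close>

lemma sums_integral_dominated:
  fixes f :: "nat \<Rightarrow> 'a \<Rightarrow> 'b::{banach,second_countable_topology}"
  assumes f: "\<And>i. f i \<in> borel_measurable M" and s: "\<And>x. (\<lambda>i. f i x) sums s x"
    and w: "integrable M w" and le: "\<And>n x. norm (\<Sum>i<n. f i x) \<le> w x"
  shows "(\<lambda>i. integral\<^sup>L M (f i)) sums integral\<^sup>L M s"
proof -
  have int: "integrable M (f i)" for i
  proof (rule Bochner_Integration.integrable_bound)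
    show "integrable M (\<lambda>x. 2 * w x)" using w by simp
    have "norm (f i x) \<le> norm (2 * w x)" for x
      using norm_triangle_ineq4[of "\<Sum>j<Suc i. f j x" "\<Sum>j<i. f j x"]
        le[where x = x and n = i] le[where x = x and n = "Suc i"] by simp
    then show "AE x in M. norm (f i x) \<le> norm (2 * w x)" by simp
  qed (rule f)
  have "(\<lambda>n. LINT x|M. (\<Sum>i<n. f i x)) \<longlonglongrightarrow> integral\<^sup>L M s"
  proof (rule integral_dominated_convergence[OF _ _ w])
    show "s \<in> borel_measurable M"
    proof (rule borel_measurable_LIMSEQ_metric)
      show "\<And>n. (\<lambda>x. \<Sum>i<n. f i x) \<in> borel_measurable M" using f by auto
      show "\<And>x. (\<lambda>n. \<Sum>i<n. f i x) \<longlonglongrightarrow> s x" using s by (simp add: sums_def)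
    qed
  qed (use f s le in \<open>auto simp: sums_def\<close>)
  then show ?thesis using int by (simp add: sums_def Bochner_Integration.integral_sum)
qed

text \<open>Termwise comparison with the exponential series of \<open>A * norm z\<close>. With the
  factorials split off, growth \<open>C * A ^ k\<close> of the coefficients means exponential type
  \<open>A\<close>. The bound is uniform in \<open>n\<close>, so it can dominate partial sums under
  an integral.\<close>

lemma norm_exp_partial_sum_le:
  fixes c :: "nat \<Rightarrow> complex"
  assumes c: "\<And>k. norm (c k) \<le> C * A ^ k" and "A \<ge> 0"
  shows "norm (\<Sum>k<n. c k * z ^ k / fact k) \<le> C * exp (A * norm z)"
proof -
  have C: "C \<ge> 0" using order_trans[OF norm_ge_zero c[of 0]] by simp
  have "norm (\<Sum>k<n. c k * z ^ k / fact k) \<le> (\<Sum>k<n. C * ((A * norm z) ^ k /\<^sub>R fact k))"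
  proof (rule sum_norm_le)
    show "norm (c k * z ^ k / fact k) \<le> C * ((A * norm z) ^ k /\<^sub>R fact k)" for k
      using mult_right_mono[OF c[of k], of "norm z ^ k"]
      by (simp add: norm_mult norm_divide norm_power divide_simps power_mult_distrib mult.assoc)
  qed
  also have "\<dots> = C * (\<Sum>k<n. (A * norm z) ^ k /\<^sub>R fact k)" by (simp add: sum_distrib_left)
  also have "\<dots> \<le> C * exp (A * norm z)"
    unfolding exp_def using C \<open>A \<ge> 0\<close>
    by (intro mult_left_mono sum_le_suminf summable_exp_generic) auto
  finally show ?thesis .
qed

lemma summable_exp_type:
  fixes c :: "nat \<Rightarrow> complex"
  assumes c: "\<And>k. norm (c k) \<le> C * A ^ k"
  shows "summable (\<lambda>k. c k * z ^ k / fact k)"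
proof (rule summable_comparison_test')
  show "summable (\<lambda>k. C * ((A * norm z) ^ k /\<^sub>R fact k))"
    by (intro summable_mult summable_exp_generic)
  show "norm (c k * z ^ k / fact k) \<le> C * ((A * norm z) ^ k /\<^sub>R fact k)" for k
    using mult_right_mono[OF c[of k], of "norm z ^ k"]
    by (simp add: norm_mult norm_divide norm_power divide_simps power_mult_distrib mult.assoc)
qed

lemma norm_exp_type_le:
  fixes c :: "nat \<Rightarrow> complex"
  assumes c: "\<And>k. norm (c k) \<le> C * A ^ k" and A: "A \<ge> 0"
  shows "norm (\<Sum>k. c k * z ^ k / fact k) \<le> C * exp (A * norm z)"
  using summable_LIMSEQ[OF summable_exp_type[OF c], THEN tendsto_norm]
  by (rule LIMSEQ_le_const2) (use norm_exp_partial_sum_le[OF c A] in auto)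

lemma power_series_entire:
  assumes "\<And>z. (\<lambda>k. a k * z ^ k) sums f z"
  shows "f holomorphic_on UNIV"
  unfolding holomorphic_on_def
proof
  fix x :: complex
  have "f holomorphic_on ball 0 (norm x + 1)"
    by (rule power_series_holomorphic[where a = a]) (use assms in simp)
  then have "f field_differentiable at x within ball 0 (norm x + 1)"
    by (simp add: holomorphic_on_def)
  then have "f field_differentiable at x"
    by (subst (asm) at_within_open) auto
  then show "f field_differentiable at x within UNIV" by simp
qed

lemma holomorphic_exp_type:
  fixes c :: "nat \<Rightarrow> complex"
  assumes c: "\<And>k. norm (c k) \<le> C * A ^ k"
  shows "(\<lambda>z. \<Sum>k. c k * z ^ k / fact k) holomorphic_on UNIV"
  by (rule power_series_entire[where a = "\<lambda>k. c k / fact k"])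
     (use summable_sums[OF summable_exp_type[OF c]] in simp)

lemma sums_power_shift:
  fixes c :: "nat \<Rightarrow> complex"
  assumes "(\<lambda>k. c k * z ^ Suc k) sums s"
  shows "(\<lambda>k. (case k of 0 \<Rightarrow> 0 | Suc k \<Rightarrow> c k) * z ^ k) sums s"
  using assms sums_Suc_iff[of "\<lambda>k. (case k of 0 \<Rightarrow> 0 | Suc k \<Rightarrow> c k) * z ^ k" s] by simp

lemma power_series_eq_0:
  fixes c :: "nat \<Rightarrow> complex"
  assumes r: "r > 0" and s: "\<And>z. norm z < r \<Longrightarrow> (\<lambda>n. c n * z ^ n) sums f z"
    and f: "\<And>z. norm z < r \<Longrightarrow> z \<noteq> 0 \<Longrightarrow> f z = 0"
  shows "c n = 0"
proof (rule ccontr)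
  assume n: "c n \<noteq> 0"
  \<comment> \<open>Zeros of a nonzero power series are isolated. The factor \<open>z\<close> makes
    the function vanish at 0 and moves \<open>c n\<close> to the positive index
    \<open>Suc n\<close>, so \<open>n = 0\<close> needs no separate case.\<close>
  obtain t where t: "0 < t" "\<And>z. z \<in> cball 0 t - {0} \<Longrightarrow> z * f z \<noteq> 0"
  proof (rule powser_0_nonzero[of r 0 "\<lambda>k. case k of 0 \<Rightarrow> 0 | Suc k \<Rightarrow> c k" "\<lambda>z. z * f z" "Suc n"])
    show "(\<lambda>k. (case k of 0 \<Rightarrow> 0 | Suc k \<Rightarrow> c k) * (z - 0) ^ k) sums (z * f z)"
      if "norm (z - 0) < r" for z
      using sums_mult[OF s, of z z] that
      by (intro sums_power_shift) (simp_all add: mult_ac)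
  qed (use r n in auto)
  define z where "z = complex_of_real (min t (r/2))"
  have "norm z < r" "z \<noteq> 0" "norm z \<le> t" using r t by (auto simp: z_def)
  with f[of z] t(2)[of z] show False by simp
qed

section \<open>Laplace transforms of functions of exponential type\<close>

text \<open>The Gamma integral, read off from the total mass 1 of the Erlang density. It evaluates
  the Laplace transforms of monomials, and its case \<open>k = 0\<close> supplies the dominating
  exponentials.\<close>

lemma erlang_integral:
  fixes w :: real
  assumes "w > 0"
  shows "integrable lborel (\<lambda>t. indicator {0..} t * (t ^ k / fact k * exp (- w * t)))"
    and "(LINT t|lborel. indicator {0..} t * (t ^ k / fact k * exp (- w * t))) = 1 / w ^ Suc k"
proof -
  have e: "(\<lambda>t. indicator {0..} t * (t ^ k / fact k * exp (- w * t)))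
      = (\<lambda>t. 1 / w ^ Suc k * erlang_density k w t)"
    using assms by (auto simp: erlang_density_def fun_eq_iff)
  have "has_bochner_integral lborel (erlang_density k w) 1"
  proof (rule has_bochner_integral_nn_integral)
    show "(\<integral>\<^sup>+ x. ennreal (erlang_density k w x) \<partial>lborel) = ennreal 1"
      using prob_space.emeasure_space_1[OF prob_space_erlang_density[OF assms, of k]]
      by (simp add: emeasure_density)
  qed (use assms in auto)
  then have "has_bochner_integral lborel (\<lambda>t. 1 / w ^ Suc k * erlang_density k w t) (1 / w ^ Suc k * 1)"
    by (rule has_bochner_integral_mult_right)
  then show "integrable lborel (\<lambda>t. indicator {0..} t * (t ^ k / fact k * exp (- w * t)))"
    "(LINT t|lborel. indicator {0..} t * (t ^ k / fact k * exp (- w * t))) = 1 / w ^ Suc k"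
    unfolding e by (auto simp: has_bochner_integral_iff)
qed


text \<open>The Laplace transform \<open>L\<close> of \<phi> along the positive axis is entire by
  the decay, and outside the disc of radius \<open>A\<close> it equals the Borel transform
  \<open>B (1 / w)\<close>. The latter tends to 0 at infinity, so Liouville gives
  \<open>L = 0\<close>, and the coefficients of \<open>B\<close> are the \<open>c k\<close>.\<close>

lemma rapid_decay_on_ray_imp_zero:
  fixes c :: "nat \<Rightarrow> complex"
  defines "\<phi> \<equiv> \<lambda>z. \<Sum>k. c k * z ^ k / fact k"
  assumes c: "\<And>k. norm (c k) \<le> C * A ^ k" and A: "A > 0"
    and decay: "\<And>N. \<exists>K. \<forall>t\<ge>0. norm (\<phi> (of_real t)) \<le> K * exp (- N * t)"
  shows "c k = 0"
proof -
  define L :: "complex \<Rightarrow> complex" where "L w = (LINT t|lborel. indicator {0..} t *\<^sub>R (\<phi> (of_real t) * exp (- (w * of_real t))))" for w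
  define B :: "complex \<Rightarrow> complex" where "B u = (\<Sum>k. c k * u ^ Suc k)" for u
  have \<phi>_sums: "(\<lambda>k. c k * z ^ k / fact k) sums \<phi> z" for z
    unfolding \<phi>_def by (rule summable_sums[OF summable_exp_type[OF c]])
  have cont: "continuous_on UNIV \<phi>"
    unfolding \<phi>_def by (rule holomorphic_on_imp_continuous_on[OF holomorphic_exp_type[OF c]])
  have [measurable]: "(\<lambda>t::real. \<phi> (of_real t)) \<in> borel_measurable borel"
    by (intro borel_measurable_continuous_onI continuous_intros continuous_on_compose2[OF cont]) auto

  have "L holomorphic_on UNIV"
  proof (rule power_series_entire)
    fix w :: complex
    \<comment> \<open>The exponential \<open>exp (- w t)\<close> is expanded under the integral. Its
      partial sums grow at most like \<open>exp (norm w * t)\<close>, so decay at rate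
      \<open>norm w + 1\<close> leaves the integrable bound \<open>K * exp (- t)\<close>.\<close>
    obtain K where K: "\<And>t. t \<ge> 0 \<Longrightarrow> norm (\<phi> (of_real t)) \<le> K * exp (- (norm w + 1) * t)"
      using decay by blast
    let ?f = "\<lambda>k t. indicator {0..} t *\<^sub>R (\<phi> (of_real t) * ((- (w * of_real t)) ^ k / fact k))"
    have "(\<lambda>k. integral\<^sup>L lborel (?f k)) sums L w"
      unfolding L_def
    proof (rule sums_integral_dominated)
      show "integrable lborel (\<lambda>t. K * (indicator {0..} t * (t ^ 0 / fact 0 * exp (- 1 * t))))"
        by (intro integrable_mult_right erlang_integral) auto
      show "(\<lambda>k. ?f k t) sums (indicator {0..} t *\<^sub>R (\<phi> (of_real t) * exp (- (w * of_real t))))" for t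
        using exp_converges[of "- (w * of_real t)"]
        by (intro sums_scaleR_right sums_mult) (simp add: scaleR_conv_of_real field_simps)
      show "norm (\<Sum>i<n. ?f i t) \<le> K * (indicator {0..} t * (t ^ 0 / fact 0 * exp (- 1 * t)))" for n t
      proof (cases "t \<ge> 0")
        case True
        have "norm (\<Sum>i<n. ?f i t) = norm (\<phi> (of_real t)) * norm (\<Sum>i<n. 1 * (- (w * of_real t)) ^ i / fact i)"
          using True by (simp add: sum_distrib_left norm_mult[symmetric])
        also have "\<dots> \<le> (K * exp (- (norm w + 1) * t)) * exp (norm w * t)"
          using norm_exp_partial_sum_le[of "\<lambda>_. 1" 1 1 "- (w * of_real t)" n] True
            order_trans[OF norm_ge_zero K[OF True]]
          by (intro mult_mono[OF K]) (auto simp: norm_mult)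
        also have "\<dots> = K * exp (- t)"
          by (simp add: mult_exp_exp algebra_simps)
        finally show ?thesis using True by simp
      qed auto
    qed measurable
    moreover have "integral\<^sup>L lborel (?f k) =
        (LINT t|lborel. indicator {0..} t *\<^sub>R (\<phi> (of_real t) * ((- of_real t) ^ k / fact k))) * w ^ k" for k
      by (subst integral_mult_left_zero[symmetric], rule Bochner_Integration.integral_cong)
         (auto simp: power_mult_distrib power_minus[of "_ * _"] power_minus[of "complex_of_real _"])
    ultimately show "(\<lambda>k. (LINT t|lborel. indicator {0..} t *\<^sub>R
        (\<phi> (of_real t) * ((- of_real t) ^ k / fact k))) * w ^ k) sums L w"
      by simp
  qed

  have B_sums: "(\<lambda>k. c k * u ^ Suc k) sums B u" if "norm u < 1 / A" for u
    unfolding B_def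
  proof (rule summable_sums, rule summable_comparison_test')
    show "summable (\<lambda>k. C * norm u * (A * norm u) ^ k)"
      using that A by (intro summable_mult summable_geometric) (auto simp: field_simps)
    show "norm (c k * u ^ Suc k) \<le> C * norm u * (A * norm u) ^ k" for k
      using mult_right_mono[OF c[of k], of "norm u ^ Suc k"]
      by (simp add: norm_mult norm_power power_mult_distrib mult_ac)
  qed
  have B_hol: "B holomorphic_on ball 0 (1 / A)"
  proof (rule power_series_holomorphic)
    fix w :: complex assume "w \<in> ball 0 (1 / A)"
    then have "(\<lambda>k. c k * w ^ Suc k) sums B w" by (intro B_sums) simp
    then show "(\<lambda>k. (case k of 0 \<Rightarrow> 0 | Suc k \<Rightarrow> c k) * (w - 0) ^ k) sums B w"
      using sums_power_shift by simp
  qed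

  \<comment> \<open>Here \<phi> is expanded instead: \<open>C * exp (- (w - A) * t)\<close>
    dominates, and the term of index \<open>k\<close> integrates to \<open>c k / w ^ Suc k\<close>.
    Real \<open>w\<close> suffice for the identity theorem.\<close>
  have L_real: "L (of_real w) = B (1 / of_real w)" if w: "w > A" for w :: real
  proof -
    let ?f = "\<lambda>k t. indicator {0..} t *\<^sub>R (c k * of_real t ^ k / fact k * exp (- (of_real w * of_real t)))"
    have "(\<lambda>k. integral\<^sup>L lborel (?f k)) sums L (of_real w)"
      unfolding L_def
    proof (rule sums_integral_dominated)
      show "integrable lborel (\<lambda>t. C * (indicator {0..} t * (t ^ 0 / fact 0 * exp (- (w - A) * t))))"
        using w by (intro integrable_mult_right erlang_integral) auto
      show "(\<lambda>k. ?f k t) sums (indicator {0..} t *\<^sub>R (\<phi> (of_real t) * exp (- (of_real w * of_real t))))" for t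
        by (intro sums_scaleR_right sums_mult2 \<phi>_sums)
      show "norm (\<Sum>i<n. ?f i t) \<le> C * (indicator {0..} t * (t ^ 0 / fact 0 * exp (- (w - A) * t)))" for n t
      proof (cases "t \<ge> 0")
        case True
        have "norm (\<Sum>i<n. ?f i t) = norm (\<Sum>i<n. c i * of_real t ^ i / fact i) * exp (- (w * t))"
        proof -
          have "(\<Sum>i<n. ?f i t) = (\<Sum>i<n. c i * of_real t ^ i / fact i) * exp (- (of_real w * of_real t))"
            using True by (simp add: sum_distrib_right)
          then show ?thesis by (simp add: norm_mult norm_exp_eq_Re)
        qed
        also have "\<dots> \<le> (C * exp (A * t)) * exp (- (w * t))"
          using norm_exp_partial_sum_le[OF c, of "of_real t" n] A True
          by (intro mult_right_mono) auto
        also have "\<dots> = C * exp (- (w - A) * t)"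
          by (simp add: mult_exp_exp algebra_simps)
        finally show ?thesis using True by simp
      qed auto
    qed measurable
    moreover have "integral\<^sup>L lborel (?f k) = c k * (1 / of_real w) ^ Suc k" for k
    proof -
      have "integral\<^sup>L lborel (?f k) = (LINT t|lborel. c k *
          complex_of_real (indicator {0..} t * (t ^ k / fact k * exp (- w * t))))"
        by (rule Bochner_Integration.integral_cong) (auto simp: exp_of_real[symmetric] scaleR_conv_of_real)
      also have "\<dots> = c k * of_real (1 / w ^ Suc k)"
        using w A by (subst integral_mult_right_zero, subst integral_complex_of_real, subst erlang_integral) auto
      finally show ?thesis by (simp add: power_divide)
    qed
    ultimately have "(\<lambda>k. c k * (1 / of_real w) ^ Suc k) sums L (of_real w)"
      by simp
    then show ?thesis unfolding B_def by (simp add: sums_iff)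
  qed

  have inv: "norm (inverse w) < 1 / A" if "norm w > A" for w :: complex
    using that A by (simp add: norm_inverse divide_inverse less_imp_inverse_less)
  \<comment> \<open>Both sides are holomorphic on the exterior of the disc, which is connected, and
    agree on the real ray beyond \<open>A\<close>, which accumulates at
    \<open>A + 1\<close>.\<close>
  have L_eq: "L w = B (inverse w)" if w: "norm w > A" for w
  proof -
    have "L w - B (inverse w) = 0"
    proof (rule analytic_continuation[where f = "\<lambda>w. L w - B (inverse w)"])
      show "(\<lambda>w. L w - B (inverse w)) holomorphic_on - cball 0 A"
      proof (intro holomorphic_on_diff)
        have "(B \<circ> inverse) holomorphic_on - cball 0 A"
          using A inv by (intro holomorphic_on_compose_gen[OF _ B_hol] holomorphic_intros) auto
        then show "(\<lambda>w. B (inverse w)) holomorphic_on - cball 0 A" by (simp add: o_def)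
      qed (use \<open>L holomorphic_on UNIV\<close> holomorphic_on_subset in blast)
      show "connected (- cball (0::complex) A)"
        by (rule connected_complement_bounded_convex) auto
      show "of_real (A + 1) islimpt complex_of_real ` {A<..}"
        unfolding islimpt_approachable
      proof (intro allI impI)
        fix e :: real assume "e > 0"
        then show "\<exists>x'\<in>complex_of_real ` {A<..}. x' \<noteq> of_real (A + 1) \<and> dist x' (of_real (A + 1)) < e"
          by (intro bexI[of _ "of_real (A + 1 + e / 2)"])
             (auto simp del: of_real_add simp: dist_of_real dist_real_def)
      qed
      show "L z - B (inverse z) = 0" if "z \<in> complex_of_real ` {A<..}" for z
        using that L_real by (auto simp: inverse_eq_divide)
    qed (use A w in \<open>auto simp del: of_real_add\<close>)
    then show ?thesis by simp
  qed

  \<comment> \<open>\<open>B\<close> has no constant term, so \<open>B (inverse w)\<close> tends to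
    \<open>B 0 = 0\<close>.\<close>
  have "(L \<longlongrightarrow> 0) at_infinity"
  proof -
    have "B 0 = 0" by (simp add: B_def)
    moreover have "isCont B 0"
      using B_hol A by (intro continuous_on_interior[OF holomorphic_on_imp_continuous_on]) auto
    ultimately have "((\<lambda>w. B (inverse w)) \<longlongrightarrow> 0) at_infinity"
      using isCont_tendsto_compose[OF _ tendsto_inverse_0, of B] by metis
    moreover have "\<forall>\<^sub>F w in at_infinity. B (inverse w) = L w"
      unfolding eventually_at_infinity using L_eq by (intro exI[of _ "A + 1"]) auto
    ultimately show ?thesis by (rule Lim_transform_eventually)
  qed
  then have L0: "L w = 0" for w
    using Liouville_weak_0 \<open>L holomorphic_on UNIV\<close> by blast
  have B0: "B u = 0" if "norm u < 1 / A" "u \<noteq> 0" for u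
  proof -
    have "norm (inverse u) > A"
      using that A less_imp_inverse_less[of "norm u" "1 / A"] by (simp add: norm_inverse)
    then show ?thesis using L_eq[of "inverse u"] L0 by simp
  qed
  show "c k = 0"
  \<comment> \<open>The series with coefficients \<open>c n\<close> sums to \<open>B z / z\<close>
    off the origin and to \<open>c 0\<close> at it; its vanishing is known off the origin
    only.\<close>
  proof (rule power_series_eq_0[where r = "1 / A" and f = "\<lambda>z. if z = 0 then c 0 else B z / z"])
    show "(\<lambda>n. c n * z ^ n) sums (if z = 0 then c 0 else B z / z)" if "norm z < 1 / A" for z
      using sums_divide[OF B_sums[OF that], of z] powser_sums_zero[of c] by auto
    show "(if z = 0 then c 0 else B z / z) = 0" if "norm z < 1 / A" "z \<noteq> 0" for z
      using B0 that by simp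
  qed (use A in auto)
qed


section \<open>The chirp relation in the right half plane\<close>

lemma linear_minus_powr_bounded:
  fixes R \<delta> p :: real
  assumes "\<delta> > 0" "p > 1"
  obtains M where "\<And>t. t > 0 \<Longrightarrow> R * t - \<delta> * t powr p \<le> M"
proof
  fix t :: real assume t: "t > 0"
  \<comment> \<open>\<open>t0\<close> solves \<delta> \<open>* t powr (p - 1)\<close> = |R|. Beyond
    it the power dominates and the difference is at most 0; before it the linear term is at most |R|
    \<open>* t0\<close>.\<close>
  define t0 where "t0 = (\<bar>R\<bar> / \<delta>) powr (1 / (p - 1))"
  have t0: "t0 \<ge> 0" by (simp add: t0_def)
  show "R * t - \<delta> * t powr p \<le> \<bar>R\<bar> * (\<bar>R\<bar> / \<delta>) powr (1 / (p - 1))"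
  proof (cases "t \<le> t0")
    case True
    have "R * t \<le> \<bar>R\<bar> * t0" using t True by (intro mult_mono) auto
    moreover have "\<delta> * t powr p \<ge> 0" using assms by simp
    ultimately show ?thesis unfolding t0_def by linarith
  next
    case False
    have "\<bar>R\<bar> / \<delta> = t0 powr (p - 1)"
      using assms by (simp add: t0_def powr_powr)
    also have "\<dots> \<le> t powr (p - 1)"
      using False t0 assms by (intro powr_mono2) auto
    finally have "\<bar>R\<bar> \<le> \<delta> * t powr (p - 1)"
      using assms by (simp add: field_simps)
    then have "\<bar>R\<bar> * t \<le> \<delta> * t powr (p - 1) * t" using t by (intro mult_right_mono) auto
    also have "\<dots> = \<delta> * t powr p" using t by (simp add: powr_mult_base[symmetric] powr_diff)
    finally have "R * t \<le> \<delta> * t powr p" using abs_ge_self[of R] t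
      by (meson mult_right_mono order_less_imp_le order_trans)
    moreover have "0 \<le> \<bar>R\<bar> * (\<bar>R\<bar> / \<delta>) powr (1 / (p - 1))" by simp
    ultimately show ?thesis by linarith
  qed
qed

text \<open>The relation between the two entire functions continues from the positive axis to the
  right half plane. On a suitable ray there the chirp factor outgrows every exponential while
  \<open>G\<close> has exponential type, so \<open>F\<close> decays rapidly on that ray and must
  vanish.\<close>

lemma exp_type_chirp_imp_zero:
  fixes a b :: "nat \<Rightarrow> complex" and \<alpha> T :: real
  assumes a: "\<And>k. norm (a k) \<le> C * A ^ k" and A: "A > 0"
    and b: "\<And>k. norm (b k) \<le> D * B ^ k" and B: "B > 0"
    and \<alpha>: "\<alpha> > 1 / 2" and T: "T \<noteq> 0"
    and chirp: "\<And>s. s > 0 \<Longrightarrow> (\<Sum>k. b k * of_real s ^ k / fact k) =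
      exp (- \<i> * of_real T * of_real (s powr (2 * \<alpha>))) * (\<Sum>k. a k * of_real s ^ k / fact k)"
  shows "a k = 0"
proof -
  define F where "F z = (\<Sum>k. a k * z ^ k / fact k)" for z
  define G where "G z = (\<Sum>k. b k * z ^ k / fact k)" for z
  have hol: "F holomorphic_on S" "G holomorphic_on S" for S
    using holomorphic_exp_type[OF a] holomorphic_exp_type[OF b] holomorphic_on_subset
    unfolding F_def G_def by blast+
  \<comment> \<open>The principal power is holomorphic here because the half plane avoids its branch
    cut. The positive axis accumulates at 1, so the identity theorem applies.\<close>
  have half_plane: "G z = exp (- \<i> * of_real T * z powr of_real (2 * \<alpha>)) * F z" if z: "Re z > 0" for z
  proof -
    have "G z - exp (- \<i> * of_real T * z powr of_real (2 * \<alpha>)) * F z = 0"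
    proof (rule analytic_continuation
        [where f = "\<lambda>z. G z - exp (- \<i> * of_real T * z powr of_real (2 * \<alpha>)) * F z"])
      show "(\<lambda>z. G z - exp (- \<i> * of_real T * z powr of_real (2 * \<alpha>)) * F z) holomorphic_on {z. Re z > 0}"
        by (intro holomorphic_intros hol) (auto simp: complex_nonpos_Reals_iff)
      show "connected {z. Re z > 0}"
        by (intro convex_connected convex_halfspace_Re_gt)
      show "open {z. Re z > 0}"
        by (rule open_halfspace_Re_gt)
      show "1 islimpt complex_of_real ` {0<..}"
        unfolding islimpt_approachable
      proof (intro allI impI)
        fix e :: real assume "e > 0"
        then show "\<exists>x'\<in>complex_of_real ` {0<..}. x' \<noteq> 1 \<and> dist x' 1 < e"
          using dist_of_real[of "1 + e / 2" 1, where 'a = complex]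
          by (intro bexI[of _ "of_real (1 + e / 2)"]) (auto simp: dist_real_def simp del: of_real_add of_real_divide intro!: imageI)
      qed
      show "G z - exp (- \<i> * of_real T * z powr of_real (2 * \<alpha>)) * F z = 0"
        if z: "z \<in> complex_of_real ` {0<..}" for z
      proof -
        obtain s where s: "z = of_real s" "s > 0" using z by auto
        then have "z powr of_real (2 * \<alpha>) = of_real (s powr (2 * \<alpha>))"
          by (metis less_imp_le powr_of_real)
        then show ?thesis using chirp[OF s(2)] s by (simp add: F_def G_def)
      qed
    qed (use z in auto)
    then show ?thesis by simp
  qed
  text \<open>On the ray at angle \<open>\<theta>\<close> the number \<open>z\<^sup>2\<^sup>\<alpha>\<close> is a positive multiple of \<open>\<plusminus>\<i>\<close>, with the sign for
    which the chirp grows.\<close>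
  define \<theta> where "\<theta> = sgn T * (pi / (4 * \<alpha>))"
  \<comment> \<open>This is where \<alpha> > 1/2 enters geometrically: it keeps the ray inside the
    half plane on which the relation holds.\<close>
  have \<theta>: "\<bar>\<theta>\<bar> < pi / 2"
    using \<alpha> T pi_gt_zero by (auto simp: \<theta>_def abs_mult sgn_if field_simps)
  have ray: "norm (F (of_real t * cis \<theta>)) \<le> D * exp (B * t - \<bar>T\<bar> * t powr (2 * \<alpha>))" if t: "t > 0" for t
  proof -
    let ?z = "of_real t * cis \<theta>"
    have "?z = exp (of_real (ln t) + \<i> * of_real \<theta>)"
      using t by (simp add: exp_add exp_of_real cis_conv_exp)
    \<comment> \<open>The angle lies within the principal range, so the logarithm undoes the
      exponential and the argument of the power is exactly 2 \<alpha> \<theta>.\<close>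
    moreover have "Ln (exp (of_real (ln t) + \<i> * of_real \<theta>)) = of_real (ln t) + \<i> * of_real \<theta>"
      using \<theta> pi_gt_zero by (intro Ln_exp) (auto simp: abs_less_iff)
    ultimately have "Ln ?z = of_real (ln t) + \<i> * of_real \<theta>" by simp
    then have "?z powr of_real (2 * \<alpha>) = exp (of_real (2 * \<alpha> * ln t) + \<i> * of_real (2 * \<alpha> * \<theta>))"
      using t by (simp add: powr_def algebra_simps)
    also have "\<dots> = of_real (t powr (2 * \<alpha>)) * cis (2 * \<alpha> * \<theta>)"
      using t by (simp only: exp_add exp_of_real cis_conv_exp powr_def) simp
    also have "2 * \<alpha> * \<theta> = sgn T * (pi / 2)"
      using \<alpha> by (simp add: \<theta>_def)
    also have "cis (sgn T * (pi / 2)) = of_real (sgn T) * \<i>"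
      using T by (auto simp: sgn_if complex_eq_iff)
    finally have zp: "?z powr of_real (2 * \<alpha>) = of_real (t powr (2 * \<alpha>)) * (of_real (sgn T) * \<i>)" .
    have "- \<i> * of_real T * ?z powr of_real (2 * \<alpha>) = of_real (\<bar>T\<bar> * t powr (2 * \<alpha>))"
      unfolding zp by (simp add: complex_eq_iff abs_sgn)
    then have "G ?z = of_real (exp (\<bar>T\<bar> * t powr (2 * \<alpha>))) * F ?z"
      using half_plane[of ?z] t \<theta> cos_gt_zero_pi[of \<theta>] by (simp add: abs_less_iff flip: exp_of_real)
    then have "norm (F ?z) = norm (G ?z) * exp (- (\<bar>T\<bar> * t powr (2 * \<alpha>)))"
      by (simp add: norm_mult exp_minus)
    also have "\<dots> \<le> (D * exp (B * t)) * exp (- (\<bar>T\<bar> * t powr (2 * \<alpha>)))"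
      using norm_exp_type_le[OF b, of ?z] B t unfolding G_def
      by (intro mult_right_mono) (auto simp: norm_mult)
    finally show ?thesis by (simp add: mult_exp_exp algebra_simps)
  qed
  have D: "D \<ge> 0" using order_trans[OF norm_ge_zero b[of 0]] by simp
  \<comment> \<open>Rotating the ray onto the positive axis multiplies the coefficients by powers of
    a number of modulus 1, which leaves their bounds unchanged.\<close>
  have "a k * cis \<theta> ^ k = 0"
  proof (rule rapid_decay_on_ray_imp_zero[where C = C and A = A and c = "\<lambda>k. a k * cis \<theta> ^ k"])
    show "norm (a k * cis \<theta> ^ k) \<le> C * A ^ k" for k
      using a[of k] by (simp add: norm_mult norm_power)
    show "\<exists>K. \<forall>t\<ge>0. norm (\<Sum>k. a k * cis \<theta> ^ k * of_real t ^ k / fact k) \<le> K * exp (- N * t)" for N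
    proof -
      \<comment> \<open>The slope \<open>B + N\<close> absorbs the type \<open>B\<close> of
        \<open>G\<close> and leaves the required decay rate \<open>N\<close>.\<close>
      obtain M where M: "\<And>t. t > 0 \<Longrightarrow> (B + N) * t - \<bar>T\<bar> * t powr (2 * \<alpha>) \<le> M"
        using linear_minus_powr_bounded[of "\<bar>T\<bar>" "2 * \<alpha>" "B + N"] T \<alpha> by auto
      \<comment> \<open>The maximum with \<open>norm (F 0)\<close> covers \<open>t = 0\<close>,
        where the estimate on the open ray says nothing.\<close>
      have "norm (F (of_real t * cis \<theta>)) \<le> max (norm (F 0)) (D * exp M) * exp (- N * t)" if "t \<ge> 0" for t
      proof (cases "t = 0")
        case False
        then have "norm (F (of_real t * cis \<theta>)) \<le> D * exp (B * t - \<bar>T\<bar> * t powr (2 * \<alpha>))"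
          using ray that by simp
        also have "\<dots> \<le> D * exp (M - N * t)"
          using M[of t] that False D by (intro mult_left_mono) (auto simp: algebra_simps)
        also have "\<dots> = (D * exp M) * exp (- N * t)" by (simp add: mult_exp_exp)
        also have "\<dots> \<le> max (norm (F 0)) (D * exp M) * exp (- N * t)" by (intro mult_right_mono) auto
        finally show ?thesis .
      qed simp
      then show ?thesis unfolding F_def
        by (intro exI[of _ "max (norm (F 0)) (D * exp M)"]) (simp add: F_def power_mult_distrib mult_ac)
    qed
  qed (rule A)
  then show ?thesis by simp
qed

subsection \<open>Smoothed box indicators\<close>

lemma (in pair_sigma_finite) integrable_mult_prod:
  fixes f :: "'a \<Rightarrow> 'c::{real_normed_field,banach,second_countable_topology}"
  assumes f: "integrable M1 f" and g: "integrable M2 g"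
  shows "integrable (M1 \<Otimes>\<^sub>M M2) (\<lambda>(x, y). f x * g y)"
proof (rule Fubini_integrable)
  have [measurable]: "f \<in> borel_measurable M1" "g \<in> borel_measurable M2" using f g by auto
  show "(\<lambda>(x, y). f x * g y) \<in> borel_measurable (M1 \<Otimes>\<^sub>M M2)" by measurable
qed (use f g in \<open>auto simp: norm_mult\<close>)

lemma integral_std_normal_cis:
  "(LBINT z. std_normal_density z *\<^sub>R cis (u * z)) = of_real (exp (- u\<^sup>2 / 2))"
proof -
  have "char std_normal_distribution u = (LBINT z. std_normal_density z *\<^sub>R cis (u * z))"
    unfolding char_def by (subst integral_density) (auto simp: cis_conv_exp)
  then show ?thesis by (simp add: char_std_normal_distribution)
qed

lemma integral_gaussian_cis:
  assumes \<sigma>: "\<sigma> > 0"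
  shows "(LBINT s. exp (- (\<sigma> * s)\<^sup>2 / 2) *\<^sub>R cis (u * s)) =
    of_real (sqrt (2 * pi) / \<sigma> * exp (- (u / \<sigma>)\<^sup>2 / 2))"
proof -
  have "(LBINT s. exp (- (\<sigma> * s)\<^sup>2 / 2) *\<^sub>R cis (u * s)) =
      (1 / \<sigma>) *\<^sub>R (LBINT z. exp (- z\<^sup>2 / 2) *\<^sub>R cis (u / \<sigma> * z))"
    using \<sigma> by (subst lborel_integral_real_affine[where c = "1 / \<sigma>" and t = 0]) auto
  also have "(\<lambda>z. exp (- z\<^sup>2 / 2) *\<^sub>R cis (u / \<sigma> * z)) =
      (\<lambda>z. sqrt (2 * pi) *\<^sub>R (std_normal_density z *\<^sub>R cis (u / \<sigma> * z)))"
    by (simp add: std_normal_density_def)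
  finally show ?thesis
    by (simp only: integral_scaleR_right integral_std_normal_cis) (simp add: scaleR_conv_of_real)
qed

text \<open>\<open>gauss_box a b \<sigma>\<close> is the indicator of \<open>[a, b]\<close> convolved with the centred normal law of deviation \<open>\<sigma>\<close>;
  \<open>gauss_box_kernel a b \<sigma>\<close> is, up to normalisation, its inverse Fourier transform.\<close>

definition gauss_box :: "real \<Rightarrow> real \<Rightarrow> real \<Rightarrow> real \<Rightarrow> real" where
  "gauss_box a b \<sigma> t = (LBINT z. indicator {a..b} (t + \<sigma> * z) * std_normal_density z)"

definition gauss_box_kernel :: "real \<Rightarrow> real \<Rightarrow> real \<Rightarrow> real \<Rightarrow> complex" where
  "gauss_box_kernel a b \<sigma> s = (LBINT y. (exp (- (\<sigma> * s)\<^sup>2 / 2) * indicator {a..b} y) *\<^sub>R cis (y * s))"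

lemma integrable_gaussian:
  fixes \<sigma> :: real
  assumes "\<sigma> > 0"
  shows "integrable lborel (\<lambda>s. exp (- (\<sigma> * s)\<^sup>2 / 2))"
proof -
  have "integrable lborel (\<lambda>s. sqrt (2 * pi) * std_normal_density (0 + \<sigma> * s))"
    using assms by (intro integrable_mult_right lborel_integrable_real_affine integrable_normal_density) auto
  then show ?thesis by (simp add: std_normal_density_def)
qed

lemma borel_measurable_cis [measurable]: "cis \<in> borel_measurable borel"
  by (intro borel_measurable_continuous_onI continuous_intros)

lemma integrable_indicator_Icc: "integrable lborel (indicat_real {a..b :: real})"
  by (cases "a \<le> b") (auto intro: integrable_real_indicator)

text \<open>The phase has modulus 1, so the Gaussian times the indicator dominates. The extra
  frequency \<open>v\<close> lets the same bound serve the kernel (\<open>v = 0\<close>) and its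
  Fourier integral (\<open>v = - t\<close>).\<close>

lemma integrable_gauss_box_kernel_pair:
  assumes "\<sigma> > 0"
  shows "integrable (lborel \<Otimes>\<^sub>M lborel)
    (\<lambda>(s, y). (exp (- (\<sigma> * s)\<^sup>2 / 2) * indicator {a..b} y) *\<^sub>R cis (y * s + v * s))"
proof (rule Bochner_Integration.integrable_bound)
  show "integrable (lborel \<Otimes>\<^sub>M lborel) (\<lambda>(s, y). exp (- (\<sigma> * s)\<^sup>2 / 2) * indicat_real {a..b} y)"
    using integrable_gaussian[OF assms]
    by (intro lborel_pair.integrable_mult_prod integrable_indicator_Icc)
qed (auto simp: norm_mult)

text \<open>After swapping the integrals, the one over \<open>s\<close> is the transform of a
  Gaussian: 2 pi times the normal density of deviation \<sigma> at \<open>y - t\<close>. The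
  substitution \<open>y = t + \<sigma> * z\<close> then produces \<open>gauss_box\<close>.\<close>

lemma fourier_gauss_box_kernel:
  assumes \<sigma>: "\<sigma> > 0"
  shows "integrable lborel (gauss_box_kernel a b \<sigma>)"
    and "(LBINT s. cis (- (t * s)) * gauss_box_kernel a b \<sigma> s) = of_real (2 * pi * gauss_box a b \<sigma> t)"
proof -
  show "integrable lborel (gauss_box_kernel a b \<sigma>)"
    using lborel_pair.integrable_fst'[OF integrable_gauss_box_kernel_pair[OF \<sigma>, of a b 0]]
    by (simp add: gauss_box_kernel_def[abs_def])
  have "(LBINT s. cis (- (t * s)) * gauss_box_kernel a b \<sigma> s) =
      (LBINT s. LBINT y. (exp (- (\<sigma> * s)\<^sup>2 / 2) * indicator {a..b} y) *\<^sub>R cis (y * s + - t * s))"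
    unfolding gauss_box_kernel_def
    by (subst integral_mult_right_zero[symmetric]) (simp add: cis_mult algebra_simps)
  also have "\<dots> = (LBINT y. LBINT s. (exp (- (\<sigma> * s)\<^sup>2 / 2) * indicator {a..b} y) *\<^sub>R cis (y * s + - t * s))"
    by (rule lborel_pair.Fubini_integral[symmetric, OF integrable_gauss_box_kernel_pair[OF \<sigma>]])
  also have "\<dots> = (LBINT y. indicator {a..b} y *\<^sub>R (LBINT s. exp (- (\<sigma> * s)\<^sup>2 / 2) *\<^sub>R cis ((y - t) * s)))"
    by (subst integral_scaleR_right[symmetric]) (simp add: algebra_simps)
  also have "\<dots> = (LBINT y. complex_of_real (indicator {a..b} y * (sqrt (2 * pi) / \<sigma> * exp (- ((y - t) / \<sigma>)\<^sup>2 / 2))))"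
    unfolding integral_gaussian_cis[OF \<sigma>] by (simp add: scaleR_conv_of_real)
  also have "\<dots> = of_real (LBINT y. indicator {a..b} y * (sqrt (2 * pi) / \<sigma> * exp (- ((y - t) / \<sigma>)\<^sup>2 / 2)))"
    by (rule integral_complex_of_real)
  also have "(LBINT y. indicator {a..b} y * (sqrt (2 * pi) / \<sigma> * exp (- ((y - t) / \<sigma>)\<^sup>2 / 2))) =
      (LBINT z. 2 * pi * (indicator {a..b} (t + \<sigma> * z) * std_normal_density z))"
    using \<sigma> by (subst lborel_integral_real_affine[where c = \<sigma> and t = t])
      (auto simp: std_normal_density_def real_sqrt_mult field_simps
        simp flip: integral_mult_right_zero intro!: Bochner_Integration.integral_cong)
  finally show "(LBINT s. cis (- (t * s)) * gauss_box_kernel a b \<sigma> s) = of_real (2 * pi * gauss_box a b \<sigma> t)"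
    by (simp add: gauss_box_def)
qed

text \<open>Boundedness together with integrability will place products of these kernels in
  \<open>L2\<close>.\<close>

lemma norm_gauss_box_kernel_le:
  "norm (gauss_box_kernel a b \<sigma> s) \<le> \<bar>b - a\<bar>"
proof -
  have "norm (gauss_box_kernel a b \<sigma> s) \<le> (LBINT y. indicator {a..b} y)"
    unfolding gauss_box_kernel_def
  proof (rule Bochner_Integration.integral_norm_bound_integral)
    show "integrable lborel (\<lambda>y. (exp (- (\<sigma> * s)\<^sup>2 / 2) * indicator {a..b} y) *\<^sub>R cis (y * s))"
      by (rule Bochner_Integration.integrable_bound[where f = "\<lambda>y. indicator {a..b} y :: real"])
         (auto simp: norm_mult intro: integrable_indicator_Icc split: split_indicator)
  qed (auto intro: integrable_indicator_Icc split: split_indicator)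
  also have "\<dots> \<le> \<bar>b - a\<bar>" by (cases "a \<le> b") auto
  finally show ?thesis .
qed

lemma integrable_gauss_box:
  "integrable lborel (\<lambda>z. indicator {a..b} (t + \<sigma> * z) * std_normal_density z)"
  by (rule Bochner_Integration.integrable_bound[OF integrable_normal_density[of 1 0]])
     (auto split: split_indicator)

lemma gauss_box_nonneg: "gauss_box a b \<sigma> t \<ge> 0"
  unfolding gauss_box_def by (rule Bochner_Integration.integral_nonneg) auto

lemma borel_measurable_gauss_box [measurable]: "gauss_box a b \<sigma> \<in> borel_measurable borel"
  unfolding gauss_box_def[abs_def] by measurable

text \<open>If \<open>y = t + \<sigma> z\<close> lies in \<open>[a, b]\<close>, then \<open>t\<^sup>2 \<le> 2 y\<^sup>2 + 2 \<sigma>\<^sup>2 z\<^sup>2\<close>; integrate against the normal law.\<close>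
lemma gauss_box_le:
  assumes "\<bar>\<sigma>\<bar> \<le> 1"
  shows "gauss_box a b \<sigma> t \<le> (3 + 2 * (max \<bar>a\<bar> \<bar>b\<bar>)\<^sup>2) / (1 + t\<^sup>2)"
proof -
  define M where "M = max \<bar>a\<bar> \<bar>b\<bar>"
  have std2: "has_bochner_integral lborel (\<lambda>z. std_normal_density z * z\<^sup>2) 1"
    using std_normal_moment_even[of 1] by simp
  have std0: "has_bochner_integral lborel std_normal_density 1"
    using std_normal_moment_even[of 0] by simp
  have "(1 + t\<^sup>2) * gauss_box a b \<sigma> t =
      (LBINT z. (1 + t\<^sup>2) * (indicator {a..b} (t + \<sigma> * z) * std_normal_density z))"
    by (simp add: gauss_box_def)
  also have "\<dots> \<le> (LBINT z. (1 + 2 * M\<^sup>2) * std_normal_density z + 2 * (std_normal_density z * z\<^sup>2))"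
  proof (rule integral_mono)
    show "integrable lborel (\<lambda>z. (1 + t\<^sup>2) * (indicator {a..b} (t + \<sigma> * z) * std_normal_density z))"
      by (intro integrable_mult_right integrable_gauss_box)
    show "integrable lborel (\<lambda>z. (1 + 2 * M\<^sup>2) * std_normal_density z + 2 * (std_normal_density z * z\<^sup>2))"
      using std0 std2 by (auto simp: has_bochner_integral_iff)
    fix z :: real
    show "(1 + t\<^sup>2) * (indicator {a..b} (t + \<sigma> * z) * std_normal_density z) \<le>
        (1 + 2 * M\<^sup>2) * std_normal_density z + 2 * (std_normal_density z * z\<^sup>2)"
    proof (cases "t + \<sigma> * z \<in> {a..b}")
      case True
      define y where "y = t + \<sigma> * z"
      have "\<bar>y\<bar> \<le> M" using True by (auto simp: y_def M_def)
      then have "y\<^sup>2 \<le> M\<^sup>2" by (simp add: abs_le_square_iff[symmetric] M_def)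
      moreover have "(\<sigma> * z)\<^sup>2 \<le> z\<^sup>2"
        using assms by (simp add: abs_le_square_iff[symmetric] abs_mult mult_left_le_one_le)
      moreover have "t\<^sup>2 \<le> 2 * y\<^sup>2 + 2 * (\<sigma> * z)\<^sup>2"
      proof -
        have "2 * y\<^sup>2 + 2 * (\<sigma> * z)\<^sup>2 = t\<^sup>2 + (y + \<sigma> * z)\<^sup>2"
          by (simp add: y_def power2_eq_square algebra_simps)
        then show ?thesis by simp
      qed
      ultimately have "1 + t\<^sup>2 \<le> (1 + 2 * M\<^sup>2) + 2 * z\<^sup>2" by linarith
      then have "(1 + t\<^sup>2) * std_normal_density z \<le> ((1 + 2 * M\<^sup>2) + 2 * z\<^sup>2) * std_normal_density z"
        by (intro mult_right_mono) auto
      then show ?thesis using True by (simp add: algebra_simps)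
    qed auto
  qed
  also have "\<dots> = (1 + 2 * M\<^sup>2) * 1 + 2 * 1"
    using std0 std2 by (subst Bochner_Integration.integral_add) (auto simp: has_bochner_integral_iff)
  finally show ?thesis
    unfolding M_def[symmetric] by (subst pos_le_divide_eq) (auto simp: add_pos_nonneg algebra_simps)
qed

lemma gauss_box_tendsto:
  assumes \<sigma>: "\<sigma> \<longlonglongrightarrow> 0" and t: "t \<noteq> a" "t \<noteq> b"
  shows "(\<lambda>n. gauss_box a b (\<sigma> n) t) \<longlonglongrightarrow> indicator {a<..<b} t"
proof -
  have "(\<lambda>n. gauss_box a b (\<sigma> n) t) \<longlonglongrightarrow> (LBINT z. indicator {a<..<b} t * std_normal_density z)"
    unfolding gauss_box_def
  proof (rule integral_dominated_convergence)
    show "integrable lborel std_normal_density" by simp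
    show "AE z in lborel. (\<lambda>n. indicator {a..b} (t + \<sigma> n * z) * std_normal_density z)
        \<longlonglongrightarrow> indicator {a<..<b} t * std_normal_density z"
    proof (intro AE_I2 tendsto_mult tendsto_const)
      fix z
      have lim: "(\<lambda>n. t + \<sigma> n * z) \<longlonglongrightarrow> t"
        using tendsto_add[OF tendsto_const[of t] tendsto_mult_left_zero[OF \<sigma>, of z]] by simp
      \<comment> \<open>Off the endpoints \<open>t\<close> lies in the open interval or in the open
        complement of the closed one, so the perturbed point eventually stays on the same
        side.\<close>
      have "\<forall>\<^sub>F n in sequentially. indicat_real {a<..<b} t = indicator {a..b} (t + \<sigma> n * z)"
      proof (cases "t \<in> {a<..<b}")
        case True
        then have "\<forall>\<^sub>F n in sequentially. t + \<sigma> n * z \<in> {a<..<b}"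
          using topological_tendstoD[OF lim open_greaterThanLessThan] by blast
        then show ?thesis by eventually_elim (use True in auto)
      next
        case False
        then have "t \<in> - {a..b}" using t by auto
        then have "\<forall>\<^sub>F n in sequentially. t + \<sigma> n * z \<in> - {a..b}"
          using topological_tendstoD[OF lim, of "- {a..b}"] by blast
        then show ?thesis by eventually_elim (use False in auto)
      qed
      then show "(\<lambda>n. indicat_real {a..b} (t + \<sigma> n * z)) \<longlonglongrightarrow> indicator {a<..<b} t"
        by (rule Lim_transform_eventually[OF tendsto_const])
    qed
  qed (auto split: split_indicator)
  then show ?thesis using std_normal_moment_even[of 0] by (simp add: has_bochner_integral_iff)
qed

text \<open>\<open>lborel\<close> is the image of the product measure on coordinates, where the
  integral of a product factors. This carries the one-dimensional kernels to any dimension.\<close>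

lemma has_bochner_integral_prod_Basis:
  fixes k :: "'a::euclidean_space \<Rightarrow> real \<Rightarrow> 'b::{real_normed_field,banach,second_countable_topology}"
  assumes "\<And>b. b \<in> Basis \<Longrightarrow> integrable lborel (k b)"
  shows "has_bochner_integral lborel (\<lambda>x. \<Prod>b\<in>Basis. k b (x \<bullet> b)) (\<Prod>b\<in>Basis. LBINT s. k b s)"
proof -
  interpret product_sigma_finite "\<lambda>_::'a. lborel :: real measure"
    by standard
  have [measurable]: "k b \<in> borel_measurable borel" if "b \<in> Basis" for b
    using assms[OF that] by auto
  have eq: "(\<Prod>b\<in>Basis. k b ((\<Sum>i\<in>Basis. f i *\<^sub>R i) \<bullet> b)) = (\<Prod>b\<in>Basis. k b (f b))" for f
    by (intro prod.cong refl) (simp add: inner_sum_left inner_Basis if_distrib sum.If_cases cong: if_cong)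
  have meas: "(\<lambda>x::'a. \<Prod>b\<in>Basis. k b (x \<bullet> b)) \<in> borel_measurable borel" by measurable
  have T: "(\<lambda>f. \<Sum>b\<in>Basis. f b *\<^sub>R b) \<in> (\<Pi>\<^sub>M b\<in>(Basis::'a set). (lborel::real measure)) \<rightarrow>\<^sub>M borel"
    by measurable
  show ?thesis
    unfolding has_bochner_integral_iff
    by (subst (1 2) lborel_eq, subst integrable_distr_eq[OF T meas], subst integral_distr[OF T meas])
       (simp add: eq product_integrable_prod product_integral_prod assms)
qed

subsection \<open>The Fourier transform on \<open>L\<^sup>2\<close>\<close>

text \<open>Balls of integer radius exhaust the space. This makes Fubini available for the completed
  measure in which the transforms are written.\<close>

lemma sigma_finite_lebesgue: "sigma_finite_measure (lebesgue :: 'a::euclidean_space measure)"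
proof
  show "\<exists>A::'a set set. countable A \<and> A \<subseteq> sets lebesgue \<and> \<Union> A = space lebesgue \<and> (\<forall>a\<in>A. emeasure lebesgue a \<noteq> \<infinity>)"
  proof (intro exI[of _ "range (\<lambda>n::nat. cball 0 (real n))"] conjI)
    show "\<Union> (range (\<lambda>n::nat. cball (0::'a) (real n))) = space lebesgue"
      using real_arch_simple by (auto simp: mem_cball)
    show "\<forall>a\<in>range (\<lambda>n. cball (0::'a) (real n)). emeasure lebesgue a \<noteq> \<infinity>"
      using fmeasurableD2[OF lmeasurable_cball] by auto
  qed auto
qed

interpretation lebesgue: sigma_finite_measure "lebesgue :: 'a::euclidean_space measure"
  by (rule sigma_finite_lebesgue)

interpretation lebesgue_pair: pair_sigma_finite "lebesgue :: 'a::euclidean_space measure"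
  "lebesgue :: 'b::euclidean_space measure" ..

lemma borel_measurable_cis_inner [measurable]:
  fixes \<xi> :: "'a::euclidean_space"
  shows "(\<lambda>x. cis (- (x \<bullet> \<xi>))) \<in> borel_measurable lebesgue"
  by (rule measurable_completion) measurable

lemma integrable_cis_mult:
  fixes f :: "'a::euclidean_space \<Rightarrow> complex"
  assumes "integrable lebesgue f"
  shows "integrable lebesgue (\<lambda>x. cis (- (x \<bullet> \<xi>)) * f x)"
proof -
  have [measurable]: "f \<in> borel_measurable lebesgue" using assms by auto
  show ?thesis
    by (rule Bochner_Integration.integrable_bound[OF assms]) (auto simp: norm_mult)
qed

text \<open>Dominated convergence with bound \<open>norm (f x)\<close>. Continuity later turns
  identities almost everywhere into identities at every point.\<close>

lemma continuous_fourier_L1: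
  fixes f :: "'a::euclidean_space \<Rightarrow> complex"
  assumes f: "integrable lebesgue f"
  shows "continuous_on UNIV (fourier_L1 f)"
  unfolding continuous_on_sequentially
proof (intro allI ballI impI)
  fix X and \<xi> :: 'a assume "(\<forall>n. X n \<in> UNIV) \<and> X \<longlonglongrightarrow> \<xi>"
  then have X: "X \<longlonglongrightarrow> \<xi>" by simp
  have [measurable]: "f \<in> borel_measurable lebesgue" using f by auto
  have "(\<lambda>n. LINT x|lebesgue. cis (- (x \<bullet> X n)) * f x) \<longlonglongrightarrow> (LINT x|lebesgue. cis (- (x \<bullet> \<xi>)) * f x)"
  proof (rule integral_dominated_convergence)
    show "integrable lebesgue (\<lambda>x. norm (f x))" using f by simp
    show "AE x in lebesgue. (\<lambda>n. cis (- (x \<bullet> X n)) * f x) \<longlonglongrightarrow> cis (- (x \<bullet> \<xi>)) * f x"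
      by (intro AE_I2 tendsto_intros X)
  qed (auto simp: norm_mult)
  then show "(fourier_L1 f \<circ> X) \<longlonglongrightarrow> fourier_L1 f \<xi>"
    unfolding fourier_L1_def o_def by (intro tendsto_mult tendsto_const)
qed

lemma borel_measurable_fourier_L1:
  "integrable lebesgue f \<Longrightarrow> fourier_L1 f \<in> borel_measurable lebesgue"
  by (intro measurable_completion) (simp add: borel_measurable_continuous_onI continuous_fourier_L1)

lemma L2D:
  assumes "f \<in> L2"
  shows "f \<in> borel_measurable lebesgue" "integrable lebesgue (\<lambda>x. (cmod (f x))\<^sup>2)"
  using assms by (auto simp: L2_def)

lemma indicator_lebesgue_measurable:
  "S \<in> sets lebesgue \<Longrightarrow> (indicator S :: 'a::euclidean_space \<Rightarrow> complex) \<in> borel_measurable lebesgue"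
  by simp

text \<open>A crude arithmetic-geometric bound giving an integrable majorant for the product of two
  \<open>L2\<close> functions, and with \<open>z = 1\<close> for an \<open>L2\<close> function on a
  set of finite measure.\<close>

lemma norm_mult_le_sum_squares:
  fixes z w :: complex
  shows "cmod z * cmod w \<le> (cmod z)\<^sup>2 + (cmod w)\<^sup>2"
  using sum_squares_bound[of "cmod z" "cmod w"] mult_nonneg_nonneg[OF norm_ge_zero[of z] norm_ge_zero[of w]]
  by linarith

lemma integrable_L2_indicator:
  fixes f :: "'a::euclidean_space \<Rightarrow> complex"
  assumes f: "f \<in> L2" and S: "S \<in> lmeasurable"
  shows "integrable lebesgue (\<lambda>x. indicator S x * f x)"
proof (rule Bochner_Integration.integrable_bound)
  show "integrable lebesgue (\<lambda>x. indicat_real S x + (cmod (f x))\<^sup>2)"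
    using L2D[OF f] S by (intro Bochner_Integration.integrable_add integrable_real_indicator) (auto simp: fmeasurable_def)
  show "(\<lambda>x. indicator S x * f x) \<in> borel_measurable lebesgue"
    using L2D[OF f] S by (intro borel_measurable_times indicator_lebesgue_measurable) (auto simp: fmeasurable_def)
  show "AE x in lebesgue. norm (indicator S x * f x) \<le> norm (indicat_real S x + (cmod (f x))\<^sup>2)"
    using norm_mult_le_sum_squares[of 1 "f _"] by (intro AE_I2) (auto simp: norm_mult split: split_indicator)
qed

text \<open>The multiplication formula. Fubini applies because the phase has modulus 1 and the
  product of two integrable functions of separate variables is integrable.\<close>

lemma integral_fourier_mult:
  fixes f \<phi> :: "'a::euclidean_space \<Rightarrow> complex"
  assumes f: "integrable lebesgue f" and \<phi>: "integrable lebesgue \<phi>"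
  shows "(LINT \<xi>|lebesgue. (LINT x|lebesgue. cis (- (x \<bullet> \<xi>)) * f x) * \<phi> \<xi>) =
    (LINT x|lebesgue. f x * (LINT \<xi>|lebesgue. cis (- (x \<bullet> \<xi>)) * \<phi> \<xi>))"
proof -
  \<comment> \<open>The phase is jointly measurable for the product of the completed measures
    because the identity is measurable from \<open>lebesgue\<close> to \<open>borel\<close>.\<close>
  have id [measurable]: "(\<lambda>x::'a. x) \<in> lebesgue \<rightarrow>\<^sub>M borel"
    by (rule measurable_completion) simp
  have [measurable]: "f \<in> borel_measurable lebesgue" "\<phi> \<in> borel_measurable lebesgue" using f \<phi> by auto
  have [measurable]: "(\<lambda>p::'a \<times> 'a. fst p) \<in> lebesgue \<Otimes>\<^sub>M lebesgue \<rightarrow>\<^sub>M borel"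
    "(\<lambda>p::'a \<times> 'a. snd p) \<in> lebesgue \<Otimes>\<^sub>M lebesgue \<rightarrow>\<^sub>M borel"
    using measurable_compose[OF measurable_fst id] measurable_compose[OF measurable_snd id] by auto
  have "integrable (lebesgue \<Otimes>\<^sub>M lebesgue) (\<lambda>(x, \<xi>). cis (- (x \<bullet> \<xi>)) * (f x * \<phi> \<xi>))"
  proof (rule Bochner_Integration.integrable_bound[OF lebesgue_pair.integrable_mult_prod[OF f \<phi>]])
    have "(\<lambda>p. cis (- (fst p \<bullet> snd p)) * (f (fst p) * \<phi> (snd p))) \<in> borel_measurable (lebesgue \<Otimes>\<^sub>M lebesgue)"
      by measurable
    then show "(\<lambda>(x, \<xi>). cis (- (x \<bullet> \<xi>)) * (f x * \<phi> \<xi>)) \<in> borel_measurable (lebesgue \<Otimes>\<^sub>M lebesgue)"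
      by (simp add: case_prod_beta')
  qed (auto simp: norm_mult)
  from lebesgue_pair.Fubini_integral[OF this] show ?thesis
    by (simp add: mult_ac flip: integral_mult_right_zero)
qed

section \<open>Injectivity of the transform\<close>

text \<open>Boxes are stable under intersection and generate the Borel sets, so the vanishing
  spreads to all Borel sets by a Dynkin argument, then to Lebesgue sets, which differ from Borel
  sets by null sets.\<close>

lemma AE_zero_if_box_integrals_zero:
  fixes f :: "'a::euclidean_space \<Rightarrow> complex"
  assumes int: "\<And>p q. integrable lebesgue (\<lambda>x. indicator (box p q) x * f x)"
    and zero: "\<And>p q. (LINT x|lebesgue. indicator (box p q) x * f x) = 0"
  shows "AE x in lebesgue. f x = 0"
proof -
  \<comment> \<open>Cutting down to a large box makes the function integrable with total integral 0,
    as the complement step of the induction requires.\<close>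
  have "AE x in lebesgue. indicator (box (- (real n *\<^sub>R One)) (real n *\<^sub>R One)) x * f x = 0" for n
  proof -
    define h where "h x = indicator (box (- (real n *\<^sub>R One)) (real n *\<^sub>R One)) x * f x" for x
    have h: "integrable lebesgue h" unfolding h_def by (rule int)
    have h0: "integral\<^sup>L lebesgue h = 0" unfolding h_def by (rule zero)
    have set_h: "set_integrable lebesgue A h" if "A \<in> sets lebesgue" for A
      using h that unfolding set_integrable_def by (rule integrable_mult_indicator[rotated])
    have borel: "(LINT x:A|lebesgue. h x) = 0" if "A \<in> sets borel" for A
    proof -
      have "Int_stable (range (\<lambda>(a, b). box a b :: 'a set))"
        by (auto simp: Int_stable_def box_Int_box)
      moreover have "range (\<lambda>(a, b). box a b :: 'a set) \<subseteq> Pow UNIV" by simp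
      moreover have "A \<in> sigma_sets UNIV (range (\<lambda>(a, b). box a b))"
        using that by (simp add: borel_eq_box)
      ultimately show ?thesis
      proof (induction rule: sigma_sets_induct_disjoint)
        case (basic A)
        then obtain a b where A: "A = box a b" by auto
        define p where "p = (\<Sum>i\<in>Basis. max (a \<bullet> i) (- (real n *\<^sub>R One) \<bullet> i) *\<^sub>R i)"
        define q where "q = (\<Sum>i\<in>Basis. min (b \<bullet> i) ((real n *\<^sub>R One) \<bullet> i) *\<^sub>R i)"
        have "A \<inter> box (- (real n *\<^sub>R One)) (real n *\<^sub>R One) = box p q"
          unfolding A p_def q_def by (rule box_Int_box)
        then have "indicator A x *\<^sub>R h x = indicator (box p q) x * f x" for x
          by (auto simp: h_def indicator_def)
        then show ?case using zero[of p q] by (simp add: set_lebesgue_integral_def)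
      next
        case empty
        show ?case by (simp add: set_lebesgue_integral_def)
      next
        case (compl A)
        then have "A \<in> sets borel" by (simp add: borel_eq_box)
        then have A: "A \<in> sets lebesgue" by simp
        have "(LINT x:UNIV - A|lebesgue. h x) = (LINT x|lebesgue. h x - indicator A x *\<^sub>R h x)"
          unfolding set_lebesgue_integral_def
          by (rule Bochner_Integration.integral_cong) (auto simp: indicator_def)
        also have "\<dots> = 0"
          using compl(2) h set_h[OF A] h0 unfolding set_integrable_def set_lebesgue_integral_def
          by (subst Bochner_Integration.integral_diff) auto
        finally show ?case .
      next
        case (union A)
        then have "A i \<in> sets borel" for i by (auto simp: borel_eq_box)
        then have A: "A i \<in> sets lebesgue" for i by simp
        have "(LINT x:(\<Union>i. A i)|lebesgue. h x) = (\<Sum>i. LINT x:A i|lebesgue. h x)"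
          using A union(1) by (intro lebesgue_integral_countable_add set_h) (auto simp: disjoint_family_on_def)
        then show ?case using union by simp
      qed
    qed
    have "AE x in lebesgue. h x = 0"
    proof (rule lebesgue.density_zero[OF h])
      fix A :: "'a set" assume A: "A \<in> sets lebesgue"
      then obtain S N N' where N: "A = S \<union> N" "N \<subseteq> N'" "N' \<in> null_sets lborel" "S \<in> sets lborel"
        by (rule sets_completionE)
      have "AE x in lebesgue. x \<notin> N'"
        using N(3) by (intro AE_not_in null_sets_completionI)
      then have "AE x in lebesgue. indicator A x *\<^sub>R h x = indicator S x *\<^sub>R h x"
        by eventually_elim (use N in \<open>auto simp: indicator_def\<close>)
      then have "(LINT x:A|lebesgue. h x) = (LINT x:S|lebesgue. h x)"
        unfolding set_lebesgue_integral_def using A N(4) h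
        by (intro integral_cong_AE borel_measurable_scaleR borel_measurable_indicator) auto
      then show "(LINT x:A|lebesgue. h x) = 0" using borel N(4) by simp
    qed
    then show ?thesis by (simp add: h_def)
  qed
  then have "AE x in lebesgue. \<forall>n::nat. indicator (box (- (real n *\<^sub>R One)) (real n *\<^sub>R One)) x * f x = 0"
    unfolding AE_all_countable by blast
  then show ?thesis
  proof eventually_elim
    case (elim x)
    have "x \<in> (\<Union>n::nat. box (- (real n *\<^sub>R One)) (real n *\<^sub>R One))" by (simp add: UN_box_eq_UNIV)
    then obtain n :: nat where "x \<in> box (- (real n *\<^sub>R One)) (real n *\<^sub>R One)" by blast
    then show ?case using elim[rule_format, of n] by simp
  qed
qed

text \<open>Cauchy--Schwarz makes the left-hand side of the multiplication formula tend to zero along the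
  truncations of \<open>f\<close>.\<close>
lemma integral_mult_fourier_eq_0:
  fixes f \<phi> :: "'a::euclidean_space \<Rightarrow> complex"
  assumes F: "fourier_L2 f g" and g: "AE \<xi> in lebesgue. g \<xi> = 0"
    and \<phi>: "integrable lebesgue \<phi>" "\<phi> \<in> L2"
    and \<psi>: "(\<lambda>x. LINT \<xi>|lebesgue. cis (- (x \<bullet> \<xi>)) * \<phi> \<xi>) \<in> L2"
  shows "(LINT x|lebesgue. f x * (LINT \<xi>|lebesgue. cis (- (x \<bullet> \<xi>)) * \<phi> \<xi>)) = 0"
proof -
  define \<psi> where "\<psi> x = (LINT \<xi>|lebesgue. cis (- (x \<bullet> \<xi>)) * \<phi> \<xi>)" for x
  define c where "c = complex_of_real ((2 * pi) powr (- real DIM('a) / 2))"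
  have c: "c \<noteq> 0" by (simp add: c_def)
  have f: "f \<in> L2" using F by (simp add: fourier_L2_def)
  have \<psi>L2: "\<psi> \<in> L2" using \<psi> by (simp add: \<psi>_def[abs_def])
  note [measurable] = L2D(1)[OF f] L2D(1)[OF \<phi>(2)] L2D(1)[OF \<psi>L2]
  define fn where "fn n x = indicator (cball 0 (real n)) x * f x" for n :: nat and x
  have fn: "integrable lebesgue (fn n)" for n
    unfolding fn_def by (rule integrable_L2_indicator[OF f lmeasurable_cball])
  note [measurable] = borel_measurable_fourier_L1[OF fn]
  have "(\<lambda>R::real. \<integral>\<^sup>+ \<xi>. ennreal ((cmod (fourier_L1 (\<lambda>x. indicator (cball 0 R) x * f x) \<xi> - g \<xi>))\<^sup>2) \<partial>lebesgue)
        = (\<lambda>R::real. \<integral>\<^sup>+ \<xi>. ennreal ((cmod (fourier_L1 (\<lambda>x. indicator (cball 0 R) x * f x) \<xi>))\<^sup>2) \<partial>lebesgue)"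
    by (rule ext, rule nn_integral_cong_AE) (use g in eventually_elim, simp)
  then have "((\<lambda>R::real. \<integral>\<^sup>+ \<xi>. ennreal ((cmod (fourier_L1 (\<lambda>x. indicator (cball 0 R) x * f x) \<xi>))\<^sup>2) \<partial>lebesgue)
        \<longlongrightarrow> 0) at_top"
    using F by (simp add: fourier_L2_def)
  from filterlim_compose[OF this filterlim_real_sequentially]
  have lim: "(\<lambda>n. \<integral>\<^sup>+ \<xi>. ennreal ((cmod (fourier_L1 (fn n) \<xi>))\<^sup>2) \<partial>lebesgue) \<longlonglongrightarrow> 0"
    by (simp add: fn_def[abs_def])
  define I where "I = (\<integral>\<^sup>+ \<xi>. ennreal ((cmod (\<phi> \<xi>))\<^sup>2) \<partial>lebesgue)"
  have "I < top" using L2D(2)[OF \<phi>(2)] by (simp add: I_def integrable_iff_bounded)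
  then have lim': "(\<lambda>n. I * (\<integral>\<^sup>+ \<xi>. ennreal ((cmod (fourier_L1 (fn n) \<xi>))\<^sup>2) \<partial>lebesgue)) \<longlonglongrightarrow> 0"
    using ennreal_tendsto_cmult[OF _ lim, of I] by simp
  have le: "ennreal ((cmod (LINT \<xi>|lebesgue. fourier_L1 (fn n) \<xi> * \<phi> \<xi>))\<^sup>2) \<le>
      I * (\<integral>\<^sup>+ \<xi>. ennreal ((cmod (fourier_L1 (fn n) \<xi>))\<^sup>2) \<partial>lebesgue)" for n
  \<comment> \<open>In the non-integrable case the Bochner integral is 0 by convention and the bound
    is trivial.\<close>
  proof (cases "integrable lebesgue (\<lambda>\<xi>. fourier_L1 (fn n) \<xi> * \<phi> \<xi>)")
    case True
    have "ennreal ((cmod (LINT \<xi>|lebesgue. fourier_L1 (fn n) \<xi> * \<phi> \<xi>))\<^sup>2) =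
        (ennreal (cmod (LINT \<xi>|lebesgue. fourier_L1 (fn n) \<xi> * \<phi> \<xi>)))\<^sup>2"
      by (simp add: ennreal_power)
    also have "\<dots> \<le> (\<integral>\<^sup>+ \<xi>. ennreal (cmod (fourier_L1 (fn n) \<xi> * \<phi> \<xi>)) \<partial>lebesgue)\<^sup>2"
      by (intro power_mono integral_norm_bound_ennreal True) auto
    also have "\<dots> = (\<integral>\<^sup>+ \<xi>. ennreal (cmod (fourier_L1 (fn n) \<xi>)) * ennreal (cmod (\<phi> \<xi>)) \<partial>lebesgue)\<^sup>2"
      by (simp add: norm_mult ennreal_mult')
    also have "\<dots> \<le> (\<integral>\<^sup>+ \<xi>. (ennreal (cmod (fourier_L1 (fn n) \<xi>)))\<^sup>2 \<partial>lebesgue) *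
        (\<integral>\<^sup>+ \<xi>. (ennreal (cmod (\<phi> \<xi>)))\<^sup>2 \<partial>lebesgue)"
      by (rule Cauchy_Schwarz_nn_integral) measurable
    also have "\<dots> = I * (\<integral>\<^sup>+ \<xi>. ennreal ((cmod (fourier_L1 (fn n) \<xi>))\<^sup>2) \<partial>lebesgue)"
      by (simp add: I_def ennreal_power mult.commute)
    finally show ?thesis .
  qed (simp add: not_integrable_integral_eq)
  have "(\<lambda>n. ennreal ((cmod (LINT \<xi>|lebesgue. fourier_L1 (fn n) \<xi> * \<phi> \<xi>))\<^sup>2)) \<longlonglongrightarrow> 0"
    by (rule tendsto_sandwich[OF _ _ tendsto_const lim']) (use le in auto)
  then have "(\<lambda>n. (cmod (LINT \<xi>|lebesgue. fourier_L1 (fn n) \<xi> * \<phi> \<xi>))\<^sup>2) \<longlonglongrightarrow> 0"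
    by (subst (asm) ennreal_tendsto_0_iff) auto
  from tendsto_real_sqrt[OF this] have "(\<lambda>n. LINT \<xi>|lebesgue. fourier_L1 (fn n) \<xi> * \<phi> \<xi>) \<longlonglongrightarrow> 0"
    by (simp add: tendsto_norm_zero_iff)
  moreover have "(LINT \<xi>|lebesgue. fourier_L1 (fn n) \<xi> * \<phi> \<xi>) = c * (LINT x|lebesgue. fn n x * \<psi> x)" for n
    unfolding \<psi>_def integral_fourier_mult[OF fn \<phi>(1), symmetric] fourier_L1_def c_def[symmetric]
    by (simp add: mult.assoc)
  ultimately have 1: "(\<lambda>n. c * (LINT x|lebesgue. fn n x * \<psi> x)) \<longlonglongrightarrow> 0" by simp
  \<comment> \<open>On the other side of the multiplication formula the truncations converge to the
    full pairing: at each point they are eventually equal to \<open>f\<close>.\<close>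
  have "(\<lambda>n. LINT x|lebesgue. fn n x * \<psi> x) \<longlonglongrightarrow> (LINT x|lebesgue. f x * \<psi> x)"
  proof (rule integral_dominated_convergence)
    show "integrable lebesgue (\<lambda>x. (cmod (f x))\<^sup>2 + (cmod (\<psi> x))\<^sup>2)"
      using L2D(2)[OF f] L2D(2)[OF \<psi>L2] by simp
    show "AE x in lebesgue. (\<lambda>n. fn n x * \<psi> x) \<longlonglongrightarrow> f x * \<psi> x"
    proof (rule AE_I2)
      fix x :: 'a
      obtain N :: nat where "norm x \<le> real N" using real_arch_simple by blast
      then have "\<forall>\<^sub>F n in sequentially. f x * \<psi> x = fn n x * \<psi> x"
        unfolding eventually_sequentially by (intro exI[of _ N]) (auto simp: fn_def)
      then show "(\<lambda>n. fn n x * \<psi> x) \<longlonglongrightarrow> f x * \<psi> x"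
        by (rule Lim_transform_eventually[OF tendsto_const])
    qed
    show "AE x in lebesgue. cmod (fn n x * \<psi> x) \<le> (cmod (f x))\<^sup>2 + (cmod (\<psi> x))\<^sup>2" for n
      using norm_mult_le_sum_squares by (auto simp: fn_def norm_mult indicator_def)
    show "(\<lambda>x. fn n x * \<psi> x) \<in> borel_measurable lebesgue" for n
      using fn by measurable
  qed measurable
  from tendsto_mult_left[OF this, of c] 1 have "c * (LINT x|lebesgue. f x * \<psi> x) = 0"
    using LIMSEQ_unique by blast
  then show ?thesis using c by (simp add: \<psi>_def)
qed

lemma L2_if_integrable_bounded:
  assumes f: "integrable lebesgue f" and B: "\<And>x. cmod (f x) \<le> B"
  shows "f \<in> L2"
proof -
  have [measurable]: "f \<in> borel_measurable lebesgue" using f by auto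
  have "integrable lebesgue (\<lambda>x. (cmod (f x))\<^sup>2)"
  proof (rule Bochner_Integration.integrable_bound)
    show "integrable lebesgue (\<lambda>x. B * cmod (f x))" using f by simp
    show "AE x in lebesgue. norm ((cmod (f x))\<^sup>2) \<le> norm (B * cmod (f x))"
      using B by (intro AE_I2) (auto simp: power2_eq_square intro!: order_trans[OF mult_right_mono abs_ge_self])
  qed measurable
  then show ?thesis by (simp add: L2_def)
qed

lemma cis_sum: "finite A \<Longrightarrow> cis (\<Sum>i\<in>A. f i) = (\<Prod>i\<in>A. cis (f i))"
  by (induction A rule: finite_induct) (auto simp: cis_mult[symmetric])

lemma integrable_inverse_1_plus_square':
  "integrable lborel (\<lambda>t::real. inverse (1 + t\<^sup>2))"
  using integrable_inverse_1_plus_square by (simp add: set_integrable_def)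

lemma integral_prod_Basis_lebesgue:
  fixes k :: "'a::euclidean_space \<Rightarrow> real \<Rightarrow> 'b::{real_normed_field,banach,second_countable_topology}"
  assumes "\<And>b. b \<in> Basis \<Longrightarrow> integrable lborel (k b)"
  shows "integrable lebesgue (\<lambda>x::'a. \<Prod>b\<in>Basis. k b (x \<bullet> b))"
    and "(LINT x|lebesgue. (\<Prod>b\<in>Basis. k b (x \<bullet> b))) = (\<Prod>b\<in>Basis. LBINT s. k b s)"
  using has_bochner_integral_prod_Basis[of k] assms
  by (auto simp: has_bochner_integral_iff integrable_completion integral_completion borel_measurable_integrable)

text \<open>The pairing of \<open>f\<close> with the transform of each test function \<phi>
  \<open>n\<close> is 0. These transforms converge almost everywhere, under one \<open>L2\<close>
  majorant, to a multiple of a box indicator, so every box integral of \<open>f\<close>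
  vanishes.\<close>

lemma fourier_L2_inj:
  fixes f :: "'a::euclidean_space \<Rightarrow> complex"
  assumes F: "fourier_L2 f g" and g: "AE \<xi> in lebesgue. g \<xi> = 0"
  shows "AE x in lebesgue. f x = 0"
proof (rule AE_zero_if_box_integrals_zero)
  have f: "f \<in> L2" using F by (simp add: fourier_L2_def)
  show int: "integrable lebesgue (\<lambda>x. indicator (box p q) x * f x)" for p q
    by (rule integrable_L2_indicator[OF f lmeasurable_box])
  fix p q :: 'a
  define \<sigma> where "\<sigma> n = inverse (real (Suc n))" for n
  have \<sigma>: "\<sigma> n > 0" "\<bar>\<sigma> n\<bar> \<le> 1" for n by (auto simp: \<sigma>_def inverse_le_1_iff)
  have \<sigma>_lim: "\<sigma> \<longlonglongrightarrow> 0" unfolding \<sigma>_def[abs_def] by (rule LIMSEQ_inverse_real_of_nat)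
  define \<phi> where "\<phi> n \<xi> = (\<Prod>b\<in>Basis. gauss_box_kernel (p \<bullet> b) (q \<bullet> b) (\<sigma> n) (\<xi> \<bullet> b))" for n and \<xi> :: 'a
  define \<psi> where "\<psi> n x = (\<Prod>b\<in>Basis. 2 * pi * gauss_box (p \<bullet> b) (q \<bullet> b) (\<sigma> n) (x \<bullet> b))" for n and x :: 'a
  \<comment> \<open>\<open>K\<close> is the constant of \<open>gauss_box_le\<close> times 2 pi. The
    resulting product \<open>D\<close> of rational bumps is independent of \<open>n\<close>, bounded
    and integrable, hence the required majorant.\<close>
  define K where "K b = 2 * pi * (3 + 2 * (max \<bar>p \<bullet> b\<bar> \<bar>q \<bullet> b\<bar>)\<^sup>2)" for b
  define D where "D x = (\<Prod>b\<in>Basis. K b * inverse (1 + (x \<bullet> b)\<^sup>2))" for x :: 'a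
  have K: "K b \<ge> 0" for b by (simp add: K_def)
  have \<phi>_int: "integrable lebesgue (\<phi> n)" for n
    unfolding \<phi>_def by (intro integral_prod_Basis_lebesgue fourier_gauss_box_kernel \<sigma>)
  have \<phi>_L2: "\<phi> n \<in> L2" for n
  proof (rule L2_if_integrable_bounded[OF \<phi>_int])
    show "cmod (\<phi> n \<xi>) \<le> (\<Prod>b\<in>Basis. \<bar>q \<bullet> b - p \<bullet> b\<bar>)" for \<xi>
      unfolding \<phi>_def prod_norm[symmetric] by (intro prod_mono) (auto simp: norm_gauss_box_kernel_le)
  qed
  have \<phi>_fourier: "(LINT \<xi>|lebesgue. cis (- (x \<bullet> \<xi>)) * \<phi> n \<xi>) = of_real (\<psi> n x)" for n x
  proof -
    have "cis (- (x \<bullet> \<xi>)) * \<phi> n \<xi> = (\<Prod>b\<in>Basis. cis (- ((x \<bullet> b) * (\<xi> \<bullet> b))) *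
        gauss_box_kernel (p \<bullet> b) (q \<bullet> b) (\<sigma> n) (\<xi> \<bullet> b))" for \<xi>
      unfolding \<phi>_def prod.distrib
      by (subst euclidean_inner) (simp add: cis_sum sum_negf[symmetric])
    then have "(LINT \<xi>|lebesgue. cis (- (x \<bullet> \<xi>)) * \<phi> n \<xi>) =
        (\<Prod>b\<in>Basis. LBINT s. cis (- ((x \<bullet> b) * s)) * gauss_box_kernel (p \<bullet> b) (q \<bullet> b) (\<sigma> n) s)"
    proof (simp, intro integral_prod_Basis_lebesgue)
      fix b
      have k: "integrable lborel (gauss_box_kernel (p \<bullet> b) (q \<bullet> b) (\<sigma> n))"
        by (rule fourier_gauss_box_kernel[OF \<sigma>(1)])
      then have [measurable]: "gauss_box_kernel (p \<bullet> b) (q \<bullet> b) (\<sigma> n) \<in> borel_measurable borel" by auto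
      show "integrable lborel (\<lambda>s. cis (- ((x \<bullet> b) * s)) * gauss_box_kernel (p \<bullet> b) (q \<bullet> b) (\<sigma> n) s)"
        by (rule Bochner_Integration.integrable_bound[OF k]) (auto simp: norm_mult)
    qed
    then show ?thesis by (simp add: fourier_gauss_box_kernel[OF \<sigma>(1)] \<psi>_def)
  qed
  have D_int: "integrable lebesgue D"
    unfolding D_def by (intro integral_prod_Basis_lebesgue integrable_mult_right integrable_inverse_1_plus_square')
  have \<psi>_nonneg: "\<psi> n x \<ge> 0" for n x
    unfolding \<psi>_def by (intro prod_nonneg) (auto simp: gauss_box_nonneg)
  have \<psi>_le: "\<psi> n x \<le> D x" for n x
    unfolding \<psi>_def D_def
  proof (intro prod_mono conjI)
    fix b
    show "2 * pi * gauss_box (p \<bullet> b) (q \<bullet> b) (\<sigma> n) (x \<bullet> b) \<le> K b * inverse (1 + (x \<bullet> b)\<^sup>2)"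
      using mult_left_mono[OF gauss_box_le[OF \<sigma>(2)], of "2 * pi" "p \<bullet> b" "q \<bullet> b" n "x \<bullet> b"]
      by (simp add: K_def divide_inverse)
  qed (auto simp: gauss_box_nonneg)
  have D_nonneg: "D x \<ge> 0" for x using \<psi>_nonneg \<psi>_le order_trans by blast
  have D_le: "D x \<le> (\<Prod>b\<in>Basis. K b)" for x
    unfolding D_def
  proof (intro prod_mono conjI)
    fix b
    have "inverse (1 + (x \<bullet> b)\<^sup>2) \<le> 1" by (simp add: inverse_le_1_iff)
    then show "K b * inverse (1 + (x \<bullet> b)\<^sup>2) \<le> K b" using K by (intro mult_left_le)
  qed (simp add: K)
  have \<psi>_meas [measurable]: "\<psi> n \<in> borel_measurable lebesgue" for n
    unfolding \<psi>_def[abs_def] by (rule measurable_completion) measurable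
  have \<psi>_L2: "(\<lambda>x. complex_of_real (\<psi> n x)) \<in> L2" for n
  proof (rule L2_if_integrable_bounded)
    show "integrable lebesgue (\<lambda>x. complex_of_real (\<psi> n x))"
      by (rule Bochner_Integration.integrable_bound[OF D_int]) (auto simp: \<psi>_nonneg D_nonneg \<psi>_le)
    show "cmod (complex_of_real (\<psi> n x)) \<le> (\<Prod>b\<in>Basis. K b)" for x
      using order_trans[OF \<psi>_le D_le] by (simp add: \<psi>_nonneg)
  qed
  have zero: "(LINT x|lebesgue. f x * of_real (\<psi> n x)) = 0" for n
    using integral_mult_fourier_eq_0[OF F g \<phi>_int \<phi>_L2, of n] \<psi>_L2 by (simp add: \<phi>_fourier)
  have D_L2: "(\<lambda>x. complex_of_real (D x)) \<in> L2"
    using D_int D_le by (intro L2_if_integrable_bounded) (auto simp: D_nonneg)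
  have meas [measurable]: "f \<in> borel_measurable lebesgue" by (rule L2D(1)[OF f])
  have "(\<lambda>n. LINT x|lebesgue. f x * of_real (\<psi> n x)) \<longlonglongrightarrow>
      (LINT x|lebesgue. (2 * pi) ^ DIM('a) * (indicator (box p q) x * f x))"
  proof (rule integral_dominated_convergence)
    show "integrable lebesgue (\<lambda>x. (cmod (f x))\<^sup>2 + (cmod (of_real (D x)))\<^sup>2)"
      using L2D(2)[OF f] L2D(2)[OF D_L2] by (rule Bochner_Integration.integrable_add)
    show "AE x in lebesgue. norm (f x * of_real (\<psi> n x)) \<le> (cmod (f x))\<^sup>2 + (cmod (of_real (D x)))\<^sup>2" for n
    proof (rule AE_I2)
      fix x
      have "norm (f x * of_real (\<psi> n x)) \<le> cmod (f x) * cmod (of_real (D x))"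
        by (auto simp: norm_mult \<psi>_nonneg D_nonneg \<psi>_le intro: mult_left_mono)
      then show "norm (f x * of_real (\<psi> n x)) \<le> (cmod (f x))\<^sup>2 + (cmod (of_real (D x)))\<^sup>2"
        using norm_mult_le_sum_squares order_trans by blast
    qed
    \<comment> \<open>Pointwise convergence may fail on the hyperplanes carrying the faces of the
      box; these are finitely many null sets.\<close>
    have "AE x in lebesgue. \<forall>b\<in>Basis. x \<bullet> b \<noteq> p \<bullet> b \<and> x \<bullet> b \<noteq> q \<bullet> b"
    proof (rule AE_finite_allI)
      fix b :: 'a assume b: "b \<in> Basis"
      have "AE x in lebesgue. x \<notin> {x. x \<bullet> b = c}" for c
        using negligible_standard_hyperplane[OF b, of c] by (intro AE_not_in) (simp add: negligible_iff_null_sets)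
      from this[of "p \<bullet> b"] this[of "q \<bullet> b"]
      show "AE x in lebesgue. x \<bullet> b \<noteq> p \<bullet> b \<and> x \<bullet> b \<noteq> q \<bullet> b" by eventually_elim simp
    qed simp
    then show "AE x in lebesgue. (\<lambda>n. f x * of_real (\<psi> n x)) \<longlonglongrightarrow>
        (2 * pi) ^ DIM('a) * (indicator (box p q) x * f x)"
    proof eventually_elim
      case (elim x)
      have "(\<lambda>n. \<psi> n x) \<longlonglongrightarrow> (\<Prod>b\<in>Basis. 2 * pi * indicator {p \<bullet> b<..<q \<bullet> b} (x \<bullet> b))"
        unfolding \<psi>_def using elim by (intro tendsto_prod tendsto_mult tendsto_const gauss_box_tendsto \<sigma>_lim) auto
      also have "(\<Prod>b\<in>Basis. 2 * pi * indicat_real {p \<bullet> b<..<q \<bullet> b} (x \<bullet> b)) =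
          (2 * pi) ^ DIM('a) * indicator (box p q) x"
        by (auto simp: prod.distrib indicator_def mem_box intro!: prod.neutral)
      finally have "(\<lambda>n. f x * of_real (\<psi> n x)) \<longlonglongrightarrow> f x * of_real ((2 * pi) ^ DIM('a) * indicator (box p q) x)"
        by (intro tendsto_mult tendsto_const tendsto_of_real)
      moreover have "f x * of_real ((2 * pi) ^ DIM('a) * indicator (box p q) x) =
          (2 * pi) ^ DIM('a) * (indicator (box p q) x * f x)"
        by (cases "x \<in> box p q") simp_all
      ultimately show ?case by (simp only:)
    qed
    show "(\<lambda>x. (2 * pi) ^ DIM('a) * (indicator (box p q) x * f x)) \<in> borel_measurable lebesgue"
      using int[of p q] by measurable
  qed measurable
  then have "(LINT x|lebesgue. (2 * pi) ^ DIM('a) * (indicator (box p q) x * f x)) = 0"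
    unfolding zero by (rule LIMSEQ_unique[OF _ tendsto_const])
  then show "(LINT x|lebesgue. indicator (box p q) x * f x) = 0" by simp
qed

section \<open>Supports, uniqueness of the transform and its restriction to rays\<close>

text \<open>The complement of the support is a union of possibly uncountably many open sets;
  Lindelof reduces it to a countable one, for which the exceptional null sets can be united.\<close>

lemma AE_zero_outside_ess_supp:
  fixes f :: "'a::euclidean_space \<Rightarrow> complex"
  shows "AE x in lebesgue. x \<notin> ess_supp f \<longrightarrow> f x = 0"
proof -
  let ?\<U> = "{U. open U \<and> (AE x in lebesgue. x \<in> U \<longrightarrow> f x = 0)}"
  obtain \<V> where \<V>: "\<V> \<subseteq> ?\<U>" "countable \<V>" "\<Union>\<V> = \<Union>?\<U>"
    by (rule Lindelof[of ?\<U>]) auto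
  have "AE x in lebesgue. \<forall>U\<in>\<V>. x \<in> U \<longrightarrow> f x = 0"
    using \<V> by (subst AE_ball_countable) auto
  then show ?thesis
  proof eventually_elim
    case (elim x)
    show ?case
    proof
      assume "x \<notin> ess_supp f"
      then have "x \<in> \<Union>?\<U>" by (simp only: ess_supp_def Compl_iff not_not)
      then have "x \<in> \<Union>\<V>" by (simp only: \<V>(3))
      then show "f x = 0" using elim by blast
    qed
  qed
qed

text \<open>Both candidates are \<open>L2\<close> limits of the same truncated transforms, and the
  squared distance between them is at most twice the sum of the squared distances to a
  truncation.\<close>

lemma fourier_L2_unique:
  fixes f :: "'a::euclidean_space \<Rightarrow> complex"
  assumes "fourier_L2 f g" "fourier_L2 f h"
  shows "AE \<xi> in lebesgue. g \<xi> = h \<xi>"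
proof -
  define J where "J k R = (\<integral>\<^sup>+ \<xi>. ennreal ((cmod (fourier_L1 (\<lambda>x. indicator (cball 0 R) x * f x) \<xi> - k \<xi>))\<^sup>2) \<partial>lebesgue)"
    for k and R :: real
  have f: "f \<in> L2" and lim: "(J g \<longlongrightarrow> 0) at_top" "(J h \<longlongrightarrow> 0) at_top"
    using assms by (auto simp: fourier_L2_def J_def[abs_def])
  have [measurable]: "g \<in> borel_measurable lebesgue" "h \<in> borel_measurable lebesgue"
    using assms by (auto simp: fourier_L2_def L2_def)
  have le: "(\<integral>\<^sup>+ \<xi>. ennreal ((cmod (g \<xi> - h \<xi>))\<^sup>2) \<partial>lebesgue) \<le> 2 * J g R + 2 * J h R" for R
  proof -
    note [measurable] = borel_measurable_fourier_L1[OF integrable_L2_indicator[OF f lmeasurable_cball[of 0 R]]]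
    let ?F = "fourier_L1 (\<lambda>x. indicator (cball 0 R) x * f x)"
    have "(cmod (g \<xi> - h \<xi>))\<^sup>2 \<le> 2 * (cmod (?F \<xi> - g \<xi>))\<^sup>2 + 2 * (cmod (?F \<xi> - h \<xi>))\<^sup>2" for \<xi>
    proof -
      have "cmod (g \<xi> - h \<xi>) \<le> cmod (?F \<xi> - g \<xi>) + cmod (?F \<xi> - h \<xi>)"
        using norm_triangle_ineq4[of "?F \<xi> - h \<xi>" "?F \<xi> - g \<xi>"] by simp
      then have "(cmod (g \<xi> - h \<xi>))\<^sup>2 \<le> (cmod (?F \<xi> - g \<xi>) + cmod (?F \<xi> - h \<xi>))\<^sup>2"
        by (intro power_mono) auto
      then show ?thesis
        using sum_squares_bound[of "cmod (?F \<xi> - g \<xi>)" "cmod (?F \<xi> - h \<xi>)"]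
        by (simp add: power2_sum)
    qed
    then have "(\<integral>\<^sup>+ \<xi>. ennreal ((cmod (g \<xi> - h \<xi>))\<^sup>2) \<partial>lebesgue) \<le>
        (\<integral>\<^sup>+ \<xi>. 2 * ennreal ((cmod (?F \<xi> - g \<xi>))\<^sup>2) + 2 * ennreal ((cmod (?F \<xi> - h \<xi>))\<^sup>2) \<partial>lebesgue)"
      by (intro nn_integral_mono) (simp add: ennreal_mult'[symmetric] ennreal_plus[symmetric]
          flip: ennreal_numeral del: ennreal_plus)
    also have "\<dots> = 2 * J g R + 2 * J h R"
      unfolding J_def by (subst nn_integral_add, measurable) (simp add: nn_integral_cmult)
    finally show ?thesis .
  qed
  have "((\<lambda>R. 2 * J g R + 2 * J h R) \<longlongrightarrow> 2 * 0 + 2 * 0) at_top"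
    by (intro tendsto_add ennreal_tendsto_cmult lim) auto
  then have "(\<integral>\<^sup>+ \<xi>. ennreal ((cmod (g \<xi> - h \<xi>))\<^sup>2) \<partial>lebesgue) \<le> 2 * 0 + 2 * 0"
    by (rule tendsto_lowerbound) (use le in auto)
  then have "AE \<xi> in lebesgue. ennreal ((cmod (g \<xi> - h \<xi>))\<^sup>2) = 0"
    by (subst (asm) mult_zero_right, simp add: nn_integral_0_iff_AE)
  then show ?thesis by eventually_elim (simp add: ennreal_eq_0_iff)
qed

text \<open>From radius \<open>R\<close> on, truncation changes \<open>f\<close> only on a null set,
  so the integrals that tend to 0 are eventually constant and therefore equal to 0.\<close>

lemma fourier_L2_bounded_support:
  fixes f :: "'a::euclidean_space \<Rightarrow> complex"
  assumes F: "fourier_L2 f g" and supp: "AE x in lebesgue. x \<notin> cball 0 R \<longrightarrow> f x = 0"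
  shows "AE \<xi> in lebesgue. g \<xi> = fourier_L1 (\<lambda>x. indicator (cball 0 R) x * f x) \<xi>"
proof -
  let ?F = "\<lambda>R. fourier_L1 (\<lambda>x. indicator (cball 0 R) x * f x)"
  have f: "f \<in> L2" and [measurable]: "g \<in> borel_measurable lebesgue" using F by (auto simp: fourier_L2_def L2_def)
  note int = integrable_L2_indicator[OF f lmeasurable_cball]
  note [measurable] = borel_measurable_fourier_L1[OF int]
  have F_eq: "?F R' = ?F R" if "R' \<ge> R" for R'
  proof
    fix \<xi>
    have "(LINT x|lebesgue. cis (- (x \<bullet> \<xi>)) * (indicator (cball 0 R') x * f x)) =
        (LINT x|lebesgue. cis (- (x \<bullet> \<xi>)) * (indicator (cball 0 R) x * f x))"
    proof (rule integral_cong_AE)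
      show "AE x in lebesgue. cis (- (x \<bullet> \<xi>)) * (indicator (cball 0 R') x * f x) =
          cis (- (x \<bullet> \<xi>)) * (indicator (cball 0 R) x * f x)"
        using supp by eventually_elim (use that in \<open>auto simp: indicator_def\<close>)
    qed (use integrable_cis_mult[OF int] in auto)
    then show "?F R' \<xi> = ?F R \<xi>" by (simp add: fourier_L1_def)
  qed
  have "\<forall>\<^sub>F R' in at_top. (\<integral>\<^sup>+ \<xi>. ennreal ((cmod (?F R' \<xi> - g \<xi>))\<^sup>2) \<partial>lebesgue) =
      (\<integral>\<^sup>+ \<xi>. ennreal ((cmod (?F R \<xi> - g \<xi>))\<^sup>2) \<partial>lebesgue)"
    by (rule eventually_mono[OF eventually_ge_at_top[of R]]) (drule F_eq, simp only:)
  moreover have "((\<lambda>R. \<integral>\<^sup>+ \<xi>. ennreal ((cmod (?F R \<xi> - g \<xi>))\<^sup>2) \<partial>lebesgue) \<longlongrightarrow> 0) at_top"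
    using F by (simp add: fourier_L2_def)
  ultimately have "((\<lambda>R'::real. \<integral>\<^sup>+ \<xi>. ennreal ((cmod (?F R \<xi> - g \<xi>))\<^sup>2) \<partial>lebesgue) \<longlongrightarrow> 0) at_top"
    by (rule Lim_transform_eventually[rotated])
  then have "(\<integral>\<^sup>+ \<xi>. ennreal ((cmod (?F R \<xi> - g \<xi>))\<^sup>2) \<partial>lebesgue) = 0"
    by (simp add: tendsto_const_iff)
  then have "AE \<xi> in lebesgue. ennreal ((cmod (?F R \<xi> - g \<xi>))\<^sup>2) = 0"
    by (simp add: nn_integral_0_iff_AE)
  then show ?thesis by eventually_elim (simp add: ennreal_eq_0_iff)
qed

text \<open>The elementary half of Paley-Wiener: expanding the phase in powers of \<open>s\<close>
  yields the moments of \<open>f\<close> in direction \<xi>. On the support the inner product is at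
  most \<open>R * norm \<xi>\<close>, which bounds the moments geometrically.\<close>

lemma fourier_L1_along_ray:
  fixes f :: "'a::euclidean_space \<Rightarrow> complex"
  assumes f: "integrable lebesgue f" and supp: "\<And>x. norm x > R \<Longrightarrow> f x = 0" and R: "R \<ge> 0"
  obtains m C where "\<And>k. norm (m k) \<le> C * (R * norm \<xi>) ^ k"
    and "\<And>s. fourier_L1 f (s *\<^sub>R \<xi>) = (\<Sum>k. m k * of_real s ^ k / fact k)"
proof
  have [measurable]: "f \<in> borel_measurable lebesgue" using f by auto
  have [measurable]: "(\<lambda>x::'a. complex_of_real (x \<bullet> \<xi>)) \<in> borel_measurable lebesgue"
    by (rule measurable_completion) measurable
  define c where "c = complex_of_real ((2 * pi) powr (- real DIM('a) / 2))"
  define \<mu> where "\<mu> k = (LINT x|lebesgue. (- \<i> * of_real (x \<bullet> \<xi>)) ^ k * f x)" for k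
  have inner: "\<bar>x \<bullet> \<xi>\<bar> \<le> R * norm \<xi>" if "f x \<noteq> 0" for x
  proof -
    have "norm x \<le> R" using supp that by force
    then show ?thesis using Cauchy_Schwarz_ineq2[of x \<xi>] mult_right_mono[of "norm x" R "norm \<xi>"] by simp
  qed
  have \<mu>_bound: "norm (\<mu> k) \<le> (LINT x|lebesgue. norm (f x)) * (R * norm \<xi>) ^ k" for k
  proof -
    have le: "norm ((- \<i> * of_real (x \<bullet> \<xi>)) ^ k * f x) \<le> norm (f x) * (R * norm \<xi>) ^ k" for x
    proof (cases "f x = 0")
      case False
      then have "\<bar>x \<bullet> \<xi>\<bar> ^ k \<le> (R * norm \<xi>) ^ k" by (intro power_mono inner) auto
      then show ?thesis by (simp add: norm_mult norm_power mult.commute mult_left_mono)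
    qed simp
    have int: "integrable lebesgue (\<lambda>x. norm (f x) * (R * norm \<xi>) ^ k)" using f by simp
    have "norm (\<mu> k) \<le> (LINT x|lebesgue. norm (f x) * (R * norm \<xi>) ^ k)"
      unfolding \<mu>_def
    proof (rule Bochner_Integration.integral_norm_bound_integral[OF _ int le])
      show "integrable lebesgue (\<lambda>x. (- \<i> * of_real (x \<bullet> \<xi>)) ^ k * f x)"
        by (rule Bochner_Integration.integrable_bound[OF int])
           (use le R in \<open>auto intro!: AE_I2 simp: abs_mult\<close>)
    qed
    then show ?thesis by simp
  qed
  show "norm (c * \<mu> k) \<le> (norm c * (LINT x|lebesgue. norm (f x))) * (R * norm \<xi>) ^ k" for k
    using mult_left_mono[OF \<mu>_bound[of k], of "norm c"] by (simp add: norm_mult mult.assoc)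
  show "fourier_L1 f (s *\<^sub>R \<xi>) = (\<Sum>k. c * \<mu> k * of_real s ^ k / fact k)" for s
  proof -
    let ?t = "\<lambda>k x. (- \<i> * of_real (x \<bullet> \<xi>)) ^ k * f x * (of_real s ^ k / fact k)"
    have "(\<lambda>k. integral\<^sup>L lebesgue (?t k)) sums (LINT x|lebesgue. cis (- (x \<bullet> (s *\<^sub>R \<xi>))) * f x)"
    proof (rule sums_integral_dominated)
      show "integrable lebesgue (\<lambda>x. exp (\<bar>s\<bar> * (R * norm \<xi>)) * norm (f x))" using f by simp
      have t: "?t k x = (- \<i> * of_real (x \<bullet> (s *\<^sub>R \<xi>))) ^ k / fact k * f x" for k x
      proof -
        have "- \<i> * of_real (x \<bullet> (s *\<^sub>R \<xi>)) = - \<i> * of_real (x \<bullet> \<xi>) * of_real s" by simp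
        then show ?thesis by (simp only: power_mult_distrib[of _ "of_real s"]) simp
      qed
      show "(\<lambda>k. ?t k x) sums (cis (- (x \<bullet> (s *\<^sub>R \<xi>))) * f x)" for x
        using exp_converges[of "- \<i> * of_real (x \<bullet> (s *\<^sub>R \<xi>))"] unfolding t
        by (intro sums_mult2) (simp add: cis_conv_exp scaleR_conv_of_real field_simps)
      show "norm (\<Sum>i<n. ?t i x) \<le> exp (\<bar>s\<bar> * (R * norm \<xi>)) * norm (f x)" for n x
      proof (cases "f x = 0")
        case False
        have "norm (\<Sum>i<n. ?t i x) =
            norm (\<Sum>i<n. 1 * (- \<i> * of_real (x \<bullet> (s *\<^sub>R \<xi>))) ^ i / fact i) * norm (f x)"
          unfolding t sum_distrib_right[symmetric] norm_mult by simp
        also have "\<dots> \<le> exp (\<bar>s\<bar> * \<bar>x \<bullet> \<xi>\<bar>) * norm (f x)"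
          using norm_exp_partial_sum_le[of "\<lambda>_. 1" 1 1 "- \<i> * of_real (x \<bullet> (s *\<^sub>R \<xi>))" n]
          by (intro mult_right_mono) (auto simp: norm_mult)
        also have "\<dots> \<le> exp (\<bar>s\<bar> * (R * norm \<xi>)) * norm (f x)"
          using inner[OF False] by (intro mult_right_mono) (auto intro: mult_left_mono)
        finally show ?thesis .
      qed simp
    qed measurable
    moreover have "integral\<^sup>L lebesgue (?t k) = \<mu> k * (of_real s ^ k / fact k)" for k
      unfolding \<mu>_def by (rule integral_mult_left_zero)
    ultimately have "(\<lambda>k. \<mu> k * (of_real s ^ k / fact k)) sums
        (LINT x|lebesgue. cis (- (x \<bullet> (s *\<^sub>R \<xi>))) * f x)"
      by (simp only:)
    from sums_mult[OF this, of c] show ?thesis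
      unfolding fourier_L1_def c_def[symmetric] by (simp add: sums_iff mult.assoc)
  qed
qed

text \<open>The set of disagreement is open, and a nonempty open set is not null.\<close>

lemma continuous_AE_eq_imp_eq:
  fixes f g :: "'a::euclidean_space \<Rightarrow> 'b::t2_space"
  assumes "continuous_on UNIV f" "continuous_on UNIV g" and ae: "AE x in lebesgue. f x = g x"
  shows "f x = g x"
proof (rule ccontr)
  assume "f x \<noteq> g x"
  moreover have open_neq: "open {x. f x \<noteq> g x}" using assms by (intro open_Collect_neq)
  ultimately have "\<not> negligible {x. f x \<noteq> g x}" using open_not_negligible by blast
  moreover have "{x. f x \<noteq> g x} \<in> null_sets lebesgue"
    using ae AE_iff_null[of lebesgue "\<lambda>x. f x = g x"] open_neq by simp
  ultimately show False by (simp add: negligible_iff_null_sets)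
qed

section \<open>Reduction of the evolution to lines through the origin\<close>

theorem corollary2p2:
  fixes \<alpha> T :: real
    and u0 :: "real ^ 'n \<Rightarrow> complex"
    and u :: "real \<Rightarrow> real ^ 'n \<Rightarrow> complex"
    and E F :: "(real ^ 'n) set"
  assumes "\<alpha> > 1 / 2"
    and "T \<noteq> 0"
    and "u0 \<in> L2"
    and "\<And>t. propagator \<alpha> t u0 (u t)"
    and "compact E" and "compact F"
    and "ess_supp (u 0) \<subseteq> E"
    and "ess_supp (u T) \<subseteq> F"
  shows "\<forall>t. AE x in lebesgue. u t x = 0"
proof -
  define M where "M t \<xi> = exp (- \<i> * of_real t * of_real (norm \<xi> powr (2 * \<alpha>)))" for t and \<xi> :: "real ^ 'n"
  have "\<forall>t. \<exists>h. fourier_L2 u0 h \<and> fourier_L2 (u t) (\<lambda>\<xi>. M t \<xi> * h \<xi>)"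
    using assms(4) by (simp add: propagator_def fourier_multiplier_def M_def frac_laplacian_symbol_def)
  \<comment> \<open>The multiplier relation picks a representative of the transform of
    \<open>u0\<close> separately for each \<open>t\<close>; uniqueness up to null sets later
    replaces them all by \<open>h 0\<close>.\<close>
  then obtain h where h: "\<And>t. fourier_L2 u0 (h t)" "\<And>t. fourier_L2 (u t) (\<lambda>\<xi>. M t \<xi> * h t \<xi>)"
    by metis
  obtain R where R: "R > 0" "E \<union> F \<subseteq> cball 0 R"
    using compact_imp_bounded[OF compact_Un[OF assms(5,6)]] unfolding bounded_pos
    by (auto simp: subset_iff)
  have supp: "AE x in lebesgue. x \<notin> cball 0 R \<longrightarrow> u t x = 0" if "t = 0 \<or> t = T" for t
  proof -
    have "ess_supp (u t) \<subseteq> cball 0 R" using that R(2) assms(7,8) by blast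
    then have "x \<in> cball 0 R" if "x \<in> ess_supp (u t)" for x using that by blast
    with AE_zero_outside_ess_supp[of "u t"] show ?thesis by (auto elim!: eventually_mono)
  qed
  define v where "v t x = indicator (cball 0 R) x * u t x" for t and x :: "real ^ 'n"
  have v_int: "integrable lebesgue (v t)" for t
    unfolding v_def using h(2)[of t] by (intro integrable_L2_indicator) (auto simp: fourier_L2_def)
  have v_hat: "AE \<xi> in lebesgue. M t \<xi> * h 0 \<xi> = fourier_L1 (v t) \<xi>" if "t = 0 \<or> t = T" for t
    using fourier_L2_bounded_support[OF h(2) supp[OF that]] fourier_L2_unique[OF h(1)[of 0] h(1)[of t]]
    by eventually_elim (simp add: v_def[abs_def])
  have v_hat_0: "AE \<xi> in lebesgue. h 0 \<xi> = fourier_L1 (v 0) \<xi>"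
    using v_hat[of 0] by (simp add: M_def)
  have v_hat_T: "AE \<xi> in lebesgue. M T \<xi> * h 0 \<xi> = fourier_L1 (v T) \<xi>"
    using v_hat[of T] by simp
  \<comment> \<open>Equality at every point is needed because a line is a null set in dimension at
    least 2. Positivity of \<alpha> makes the symbol continuous at the origin too.\<close>
  have chirp: "fourier_L1 (v T) \<xi> = M T \<xi> * fourier_L1 (v 0) \<xi>" for \<xi>
  proof (rule continuous_AE_eq_imp_eq[where f = "fourier_L1 (v T)" and g = "\<lambda>\<xi>. M T \<xi> * fourier_L1 (v 0) \<xi>"])
    show "continuous_on UNIV (\<lambda>\<xi>. M T \<xi> * fourier_L1 (v 0) \<xi>)"
      unfolding M_def using assms(1)
      by (intro continuous_intros continuous_fourier_L1 v_int continuous_on_powr') auto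
    show "AE \<xi> in lebesgue. fourier_L1 (v T) \<xi> = M T \<xi> * fourier_L1 (v 0) \<xi>"
      using v_hat_0 v_hat_T by eventually_elim simp
  qed (intro continuous_fourier_L1 v_int)
  have zero: "fourier_L1 (v 0) \<xi> = 0" if \<xi>: "\<xi> \<noteq> 0" for \<xi>
  proof -
    have v_supp: "v t x = 0" if "norm x > R" for t x using that by (simp add: v_def)
    obtain a C where a: "\<And>k. norm (a k) \<le> C * (R * norm \<xi>) ^ k"
      "\<And>s. fourier_L1 (v 0) (s *\<^sub>R \<xi>) = (\<Sum>k. a k * of_real s ^ k / fact k)"
      by (rule fourier_L1_along_ray[OF v_int[of 0] v_supp less_imp_le[OF R(1)], of \<xi>]) (assumption, rule that)
    obtain b D where b: "\<And>k. norm (b k) \<le> D * (R * norm \<xi>) ^ k"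
      "\<And>s. fourier_L1 (v T) (s *\<^sub>R \<xi>) = (\<Sum>k. b k * of_real s ^ k / fact k)"
      by (rule fourier_L1_along_ray[OF v_int[of T] v_supp less_imp_le[OF R(1)], of \<xi>]) (assumption, rule that)
    have "a k = 0" for k
    proof (rule exp_type_chirp_imp_zero[OF a(1) _ b(1)])
      show "R * norm \<xi> > 0" "R * norm \<xi> > 0" using R \<xi> by auto
      \<comment> \<open>By homogeneity of the symbol the restriction to the ray through \<xi> is a
        one-dimensional chirp whose time is \<open>T\<close> scaled by
        \<open>norm \<xi> powr (2 * \<alpha>)\<close>.\<close>
      show "T * norm \<xi> powr (2 * \<alpha>) \<noteq> 0" using assms(2) \<xi> by simp
      fix s :: real assume "s > 0"
      then have "M T (s *\<^sub>R \<xi>) = exp (- \<i> * of_real (T * norm \<xi> powr (2 * \<alpha>)) * of_real (s powr (2 * \<alpha>)))"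
        by (simp add: M_def powr_mult mult_ac)
      then show "(\<Sum>k. b k * of_real s ^ k / fact k) =
          exp (- \<i> * of_real (T * norm \<xi> powr (2 * \<alpha>)) * of_real (s powr (2 * \<alpha>))) *
            (\<Sum>k. a k * of_real s ^ k / fact k)"
        using chirp[of "s *\<^sub>R \<xi>"] by (simp add: a(2) b(2))
    qed (rule assms(1))
    \<comment> \<open>The parameter \<open>s = 1\<close> on the ray is the point \<xi>
      itself.\<close>
    then show ?thesis using a(2)[of 1] by simp
  qed
  have "AE \<xi> in lebesgue. \<xi> \<notin> {0 :: real ^ 'n}"
    by (intro AE_not_in) (simp flip: negligible_iff_null_sets)
  then have h0: "AE \<xi> in lebesgue. h 0 \<xi> = 0"
    using v_hat_0 by eventually_elim (simp add: zero)
  show ?thesis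
  proof
    fix t
    have "AE \<xi> in lebesgue. M t \<xi> * h t \<xi> = 0"
      using h0 fourier_L2_unique[OF h(1)[of 0] h(1)[of t]] by eventually_elim simp
    then show "AE x in lebesgue. u t x = 0" by (rule fourier_L2_inj[OF h(2)])
  qed
qed

end
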